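(* Let $X$ be a Banach lattice and $Y$ a Banach sequence lattice with associated Köthe space $Y^{\times}$. Then, for every $n\in\mathbb{N}$, $x_1,\dots,x_n\in X$ and $\varphi_1,\dots,\varphi_n\in X^{*}$, $$\sum_{j=1}^{n}|\varphi_j(x_j)|\le\big\langle\,\|(x_1,\dots,x_n)\|_{Y},\ \|(\varphi_1,\dots,\varphi_n)\|_{Y^{\times}}\big\rangle_{X,X^{*}},$$ where $\|(x_1,\dots,x_n)\|_Y\in X$ and $\|(\varphi_1,\dots,\varphi_n)\|_{Y^{\times}}\in X^{*}$ are defined by Krivine's functional calculus in the Banach lattices $X$ and $X^{*}$ respectively, and $\langle x,\varphi\rangle_{X,X^{*}}=\varphi(x)$.
   Context: All vector spaces are real. A Banach sequence lattice is a linear subspace $Y\subset\mathbb{R}^{\mathbb{N}}$ containing all canonical sequences $e_n$, with a complete norm $\|\cdot\|_Y$ such that if $f\in\mathbb{R}^{\mathbb{N}}$, $g\in Y$ and $|f|\le|g|$ pointwise, then $f\in Y$ and $\|f\|_Y\le\|g\|_Y$. A finite tuple $(t_1,\dots,t_n)\in\mathbb{R}^n$ is identified with $(t_1,\dots,t_n,0,0,\dots)\in Y$. Associated Köthe space: $Y^{\times}:=\{(\beta_n)\in\mathbb{R}^{\mathbb{N}}:\sum_n|\alpha_n\beta_n|<\infty\ \forall(\alpha_n)\in Y\}$ with norm $\|(\beta_n)\|_{Y^{\times}}:=\sup\{\sum_n|\alpha_n\beta_n|:\|(\alpha_n)\|_Y\le1\}$; it is again a Banach sequence lattice. Krivine's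 functional calculus: let $\mathcal{H}_n$ be the space of continuous $h:\mathbb{R}^n\to\mathbb{R}$ with $h(\lambda t)=\lambda h(t)$ for $\lambda\ge0$, with the pointwise order. For a Banach lattice $X$ and $x=(x_1,\dots,x_n)\in X^n$ there is a unique linear map $\tau_{n,x}:\mathcal{H}_n\to X$ with $\tau_{n,x}(\pi_{n,j})=x_j$ for each coordinate projection $\pi_{n,j}$ and $\tau_{n,x}(h_1\vee h_2)=\tau_{n,x}(h_1)\vee\tau_{n,x}(h_2)$. For a Banach sequence lattice $Y$ write $\|(x_1,\dots,x_n)\|_Y:=\tau_{n,x}\big(t\mapsto\|(t_1,\dots,t_n)\|_Y\big)\in X$; likewise with $Y^{\times}$ and with the dual Banach lattice $X^{*}$ (order: $\varphi_1\le\varphi_2$ iff $\varphi_1(x)\le\varphi_2(x)$ for all $x\ge0$). *)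

theory Defs
  imports "HOL-Analysis.Analysis" "HOL-Library.Lattice_Algebras"
begin

section \<open>Banach lattices\<close>

class banach_lattice = banach + ordered_real_vector + lattice_ab_group_add_abs +
  assumes norm_mono_abs: "\<bar>x\<bar> \<le> \<bar>y\<bar> \<Longrightarrow> norm x \<le> norm y"

lemma norm_mono_nonneg:
  fixes x y :: "'a::banach_lattice"
  assumes "0 \<le> x" "x \<le> y"
  shows "norm x \<le> norm y"
proof (rule norm_mono_abs)
  show "\<bar>x\<bar> \<le> \<bar>y\<bar>"
    using assms order_trans[OF assms] by simp
qed

lemma norm_pprt_le: "norm (pprt x) \<le> norm (x::'a::banach_lattice)"
proof (rule norm_mono_abs)
  show "\<bar>pprt x\<bar> \<le> \<bar>x\<bar>"
    by (simp add: abs_prts[of x])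
qed

lemma riesz_decomposition:
  fixes z u v :: "'a::lattice_ab_group_add"
  assumes "0 \<le> z" "z \<le> u + v" "0 \<le> u" "0 \<le> v"
  obtains a b where "z = a + b" "0 \<le> a" "a \<le> u" "0 \<le> b" "b \<le> v"
proof
  show "z = inf z u + (z - inf z u)"
    by (metis add.commute diff_add_cancel)
  show "0 \<le> inf z u" "inf z u \<le> u"
    using assms by auto
  show "0 \<le> z - inf z u"
    by (metis diff_ge_0_iff_ge inf_le1)
  have "z - inf z u = sup 0 (z - u)"
    unfolding diff_inf_eq_sup by (simp add: add_sup_distrib_left)
  also have "\<dots> \<le> v"
    using assms by (simp add: diff_le_eq add.commute)
  finally show "z - inf z u \<le> v" .
qed

section \<open>The dual Banach lattice\<close>

text \<open>The order on the dual is special to real-valued functionals, so it cannot be an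
  instance for the type of bounded linear functions itself; hence the copy.\<close>

typedef (overloaded) 'a dual = "UNIV :: ('a::real_normed_vector \<Rightarrow>\<^sub>L real) set"
  morphisms blinfun_of_dual Dual ..

setup_lifting type_definition_dual

lift_definition dual_apply :: "'a::real_normed_vector dual \<Rightarrow> 'a \<Rightarrow> real"
  is blinfun_apply .

instantiation dual :: (real_normed_vector) real_normed_vector
begin

lift_definition zero_dual :: "'a dual" is 0 .
lift_definition plus_dual :: "'a dual \<Rightarrow> 'a dual \<Rightarrow> 'a dual" is "(+)" .
lift_definition minus_dual :: "'a dual \<Rightarrow> 'a dual \<Rightarrow> 'a dual" is "(-)" .
lift_definition uminus_dual :: "'a dual \<Rightarrow> 'a dual" is uminus .
lift_definition scaleR_dual :: "real \<Rightarrow> 'a dual \<Rightarrow> 'a dual" is scaleR .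
lift_definition norm_dual :: "'a dual \<Rightarrow> real" is norm .

definition dist_dual :: "'a dual \<Rightarrow> 'a dual \<Rightarrow> real"
  where "dist_dual \<phi> \<psi> = norm (\<phi> - \<psi>)"
definition sgn_dual :: "'a dual \<Rightarrow> 'a dual"
  where "sgn_dual \<phi> = scaleR (inverse (norm \<phi>)) \<phi>"
definition [code del]:
  "(uniformity :: ('a dual \<times> 'a dual) filter) = (INF e\<in>{0<..}. principal {(x, y). dist x y < e})"
definition open_dual :: "'a dual set \<Rightarrow> bool"
  where [code del]: "open_dual S = (\<forall>x\<in>S. \<forall>\<^sub>F (x', y) in uniformity. x' = x \<longrightarrow> y \<in> S)"

instance
  apply standard
  unfolding dist_dual_def open_dual_def sgn_dual_def uniformity_dual_def
  by (rule refl | (transfer, simp add: algebra_simps norm_triangle_ineq))+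

end

lemma dist_dual_eq: "dist \<phi> \<psi> = dist (blinfun_of_dual \<phi>) (blinfun_of_dual \<psi>)"
  by (simp add: dist_norm norm_dual.rep_eq minus_dual.rep_eq)

instance dual :: (real_normed_vector) banach
proof
  fix F :: "nat \<Rightarrow> 'a dual"
  assume "Cauchy F"
  then have "Cauchy (\<lambda>k. blinfun_of_dual (F k))"
    by (simp add: Cauchy_def dist_dual_eq)
  then obtain L where "(\<lambda>k. blinfun_of_dual (F k)) \<longlonglongrightarrow> L"
    using Cauchy_convergent_iff convergent_def by blast
  then have "F \<longlonglongrightarrow> Dual L"
    by (simp add: lim_sequentially dist_dual_eq Dual_inverse)
  then show "convergent F"
    by (auto simp: convergent_def)
qed

lemma dual_eqI: "(\<And>x. dual_apply \<phi> x = dual_apply \<psi> x) \<Longrightarrow> \<phi> = \<psi>"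
  by transfer (rule blinfun_eqI)

lemma bounded_linear_dual_apply: "bounded_linear (dual_apply \<phi>)"
  by transfer (rule blinfun.bounded_linear_right)

lemma dual_apply_simps [simp]:
  "dual_apply 0 x = 0"
  "dual_apply (\<phi> + \<psi>) x = dual_apply \<phi> x + dual_apply \<psi> x"
  "dual_apply (\<phi> - \<psi>) x = dual_apply \<phi> x - dual_apply \<psi> x"
  "dual_apply (- \<phi>) x = - dual_apply \<phi> x"
  "dual_apply (c *\<^sub>R \<phi>) x = c * dual_apply \<phi> x"
  "dual_apply \<phi> 0 = 0"
  "dual_apply \<phi> (x + y) = dual_apply \<phi> x + dual_apply \<phi> y"
  "dual_apply \<phi> (x - y) = dual_apply \<phi> x - dual_apply \<phi> y"
  "dual_apply \<phi> (- x) = - dual_apply \<phi> x"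
  "dual_apply \<phi> (c *\<^sub>R x) = c * dual_apply \<phi> x"
  by (transfer; simp add: blinfun.bilinear_simps)+

lemma abs_dual_apply_le: "\<bar>dual_apply \<phi> x\<bar> \<le> norm \<phi> * norm x"
  using norm_blinfun[of "blinfun_of_dual \<phi>" x]
  by (simp add: dual_apply.rep_eq norm_dual.rep_eq)

lemma norm_dual_bound:
  assumes "0 \<le> b" "\<And>x. \<bar>dual_apply \<phi> x\<bar> \<le> b * norm x"
  shows "norm \<phi> \<le> b"
  using norm_blinfun_bound[OF assms(1), of "blinfun_of_dual \<phi>"] assms(2)
  by (simp add: dual_apply.rep_eq norm_dual.rep_eq)

lemma dual_of_bounded_linear:
  assumes "bounded_linear f"
  obtains \<phi> where "\<And>x. dual_apply \<phi> x = f x"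
proof
  show "dual_apply (Dual (Blinfun f)) x = f x" for x
    by (simp add: dual_apply.rep_eq Dual_inverse bounded_linear_Blinfun_apply assms)
qed

text \<open>Riesz--Kantorovich formula: the supremum in the dual is
  \<open>x \<mapsto> sup {\<phi> y + \<psi> (x - y) | 0 \<le> y \<le> x}\<close> on the positive cone.\<close>

lemma riesz_kantorovich:
  fixes \<phi> :: "'a::banach_lattice dual"
  obtains \<rho> where
    "\<And>x. 0 \<le> x \<Longrightarrow> dual_apply \<rho> x = (SUP y\<in>{0..x}. dual_apply \<phi> y)"
proof -
  define p where "p x = (SUP y\<in>{0..x}. dual_apply \<phi> y)" for x
  have bnd: "dual_apply \<phi> y \<le> norm \<phi> * norm x" if "y \<in> {0..x}" for x y
  proof -
    have "dual_apply \<phi> y \<le> norm \<phi> * norm y"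
      using abs_dual_apply_le[of \<phi> y] by linarith
    also have "\<dots> \<le> norm \<phi> * norm x"
      using that by (intro mult_left_mono norm_mono_nonneg) auto
    finally show ?thesis .
  qed
  have bdd: "bdd_above (dual_apply \<phi> ` {0..x})" for x
    using bnd by (intro bdd_aboveI2)
  have p_ge: "dual_apply \<phi> y \<le> p x" if "0 \<le> y" "y \<le> x" for x y
    unfolding p_def using that by (intro cSUP_upper bdd) auto
  have p_le: "p x \<le> c" if "0 \<le> x" "\<And>y. 0 \<le> y \<Longrightarrow> y \<le> x \<Longrightarrow> dual_apply \<phi> y \<le> c" for x c
    unfolding p_def using that by (intro cSUP_least) auto
  have p_nonneg: "0 \<le> p x" if "0 \<le> x" for x
    using p_ge[of 0 x] that by simp
  have p_bound: "p x \<le> norm \<phi> * norm x" if "0 \<le> x" for x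
    using that bnd by (intro p_le) auto
  have p_add: "p (u + v) = p u + p v" if "0 \<le> u" "0 \<le> v" for u v
  proof (rule antisym)
    show "p (u + v) \<le> p u + p v"
    proof (rule p_le)
      fix z assume "0 \<le> z" "z \<le> u + v"
      then obtain a b where "z = a + b" "0 \<le> a" "a \<le> u" "0 \<le> b" "b \<le> v"
        using riesz_decomposition \<open>0 \<le> u\<close> \<open>0 \<le> v\<close> by metis
      then show "dual_apply \<phi> z \<le> p u + p v"
        using p_ge[of a u] p_ge[of b v] by simp
    qed (use that in simp)
    have "p u \<le> p (u + v) - dual_apply \<phi> b" if "0 \<le> b" "b \<le> v" for b
    proof (rule p_le)
      fix a assume "0 \<le> a" "a \<le> u"
      then show "dual_apply \<phi> a \<le> p (u + v) - dual_apply \<phi> b"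
        using p_ge[of "a + b" "u + v"] that by (simp add: add_mono)
    qed fact
    then have "p v \<le> p (u + v) - p u"
      using \<open>0 \<le> v\<close> by (intro p_le) (auto simp: algebra_simps)
    then show "p u + p v \<le> p (u + v)"
      by simp
  qed
  have p_scale_le: "p (c *\<^sub>R x) \<le> c * p x" if "0 < c" "0 \<le> x" for c x
  proof (rule p_le)
    show "0 \<le> c *\<^sub>R x"
      using that by (simp add: scaleR_nonneg_nonneg)
    fix y assume y: "0 \<le> y" "y \<le> c *\<^sub>R x"
    have "inverse c *\<^sub>R y \<le> inverse c *\<^sub>R (c *\<^sub>R x)"
      using y that by (intro scaleR_left_mono) auto
    then have "dual_apply \<phi> (inverse c *\<^sub>R y) \<le> p x"
      using y that by (intro p_ge) (auto intro: scaleR_nonneg_nonneg)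
    then show "dual_apply \<phi> y \<le> c * p x"
      using that by (simp add: field_simps)
  qed
  have p_scale: "p (c *\<^sub>R x) = c * p x" if "0 < c" "0 \<le> x" for c x
  proof (rule antisym)
    show "c * p x \<le> p (c *\<^sub>R x)"
      using p_scale_le[of "inverse c" "c *\<^sub>R x"] that
      by (simp add: scaleR_nonneg_nonneg field_simps)
  qed (use that p_scale_le in auto)
  define g where "g x = p (pprt x) - p (pprt (- x))" for x
  have decomp: "x = pprt x - pprt (- x)" for x :: 'a
    using prts[of x] by (simp add: pprt_neg)
  have g_eq: "g (u - v) = p u - p v" if "0 \<le> u" "0 \<le> v" for u v
  proof -
    have "pprt (u - v) + v = u + pprt (- (u - v))"
      using decomp[of "u - v"] by (simp add: algebra_simps)
    then have "p (pprt (u - v)) + p v = p u + p (pprt (- (u - v)))"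
      using that by (metis p_add zero_le_pprt)
    then show ?thesis
      by (simp add: g_def)
  qed
  have p0: "p 0 = 0"
    using p_add[of 0 0] by simp
  have g_neg: "g (- x) = - g x" for x
    by (simp add: g_def)
  have g_add: "g (x + y) = g x + g y" for x y
  proof -
    have "x + y = (pprt x + pprt y) - (pprt (- x) + pprt (- y))"
      by (metis add_diff_add decomp)
    then have "g (x + y) = p (pprt x + pprt y) - p (pprt (- x) + pprt (- y))"
      by (metis g_eq add_nonneg_nonneg zero_le_pprt)
    then show ?thesis
      by (simp add: p_add g_def)
  qed
  have g_scale_pos: "g (c *\<^sub>R x) = c * g x" if "0 < c" for c x
  proof -
    have "c *\<^sub>R x = c *\<^sub>R pprt x - c *\<^sub>R pprt (- x)"
      using decomp[of x] by (metis scaleR_right_diff_distrib)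
    then have "g (c *\<^sub>R x) = p (c *\<^sub>R pprt x) - p (c *\<^sub>R pprt (- x))"
      using that by (metis g_eq less_imp_le scaleR_nonneg_nonneg zero_le_pprt)
    then show ?thesis
      using that by (simp add: p_scale g_def algebra_simps)
  qed
  have g_scale: "g (c *\<^sub>R x) = c * g x" for c x
  proof (cases c "0::real" rule: linorder_cases)
    case less
    then show ?thesis
      using g_scale_pos[of "- c" x] g_neg[of "c *\<^sub>R x"] by simp
  next
    case equal
    then show ?thesis by (simp add: g_def)
  qed (rule g_scale_pos)
  have "bounded_linear g"
  proof (rule bounded_linear_intro)
    show "norm (g x) \<le> norm x * norm \<phi>" for x
    proof -
      have le: "p (pprt x) \<le> norm \<phi> * norm x" for x
        using p_bound[of "pprt x"] norm_pprt_le[of x]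
        by (meson mult_left_mono norm_ge_zero order_trans zero_le_pprt)
      show ?thesis
        using le[of x] le[of "- x"] p_nonneg[of "pprt x"] p_nonneg[of "pprt (- x)"]
        by (simp add: g_def mult.commute)
    qed
  qed (simp_all add: g_add g_scale)
  then obtain \<rho> where \<rho>: "\<And>x. dual_apply \<rho> x = g x"
    using dual_of_bounded_linear by blast
  show thesis
  proof
    show "dual_apply \<rho> x = (SUP y\<in>{0..x}. dual_apply \<phi> y)" if "0 \<le> x" for x
      using g_eq[of x 0] that by (simp add: \<rho> p0 p_def)
  qed
qed

instantiation dual :: (banach_lattice) banach_lattice
begin

definition less_eq_dual :: "'a dual \<Rightarrow> 'a dual \<Rightarrow> bool"
  where "\<phi> \<le> \<psi> \<longleftrightarrow> (\<forall>x\<ge>0. dual_apply \<phi> x \<le> dual_apply \<psi> x)"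
definition less_dual :: "'a dual \<Rightarrow> 'a dual \<Rightarrow> bool"
  where "\<phi> < \<psi> \<longleftrightarrow> \<phi> \<le> \<psi> \<and> \<not> \<psi> \<le> (\<phi> :: 'a dual)"
definition sup_dual :: "'a dual \<Rightarrow> 'a dual \<Rightarrow> 'a dual"
  where "sup_dual \<phi> \<psi> =
    (THE \<rho>. \<phi> \<le> \<rho> \<and> \<psi> \<le> \<rho> \<and> (\<forall>\<omega>. \<phi> \<le> \<omega> \<longrightarrow> \<psi> \<le> \<omega> \<longrightarrow> \<rho> \<le> \<omega>))"
definition inf_dual :: "'a dual \<Rightarrow> 'a dual \<Rightarrow> 'a dual"
  where "inf_dual \<phi> \<psi> = - sup (- \<phi>) (- \<psi>)"
definition abs_dual :: "'a dual \<Rightarrow> 'a dual"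
  where "abs_dual \<phi> = sup \<phi> (- \<phi>)"

lemma dual_order_antisym:
  fixes \<phi> \<psi> :: "'a dual"
  assumes "\<phi> \<le> \<psi>" "\<psi> \<le> \<phi>"
  shows "\<phi> = \<psi>"
proof (rule dual_eqI)
  fix x :: 'a
  have pos: "dual_apply \<phi> u = dual_apply \<psi> u" if "0 \<le> u" for u
    using assms that by (meson less_eq_dual_def order_antisym)
  have "x = pprt x - pprt (- x)"
    using prts[of x] by (simp add: pprt_neg)
  then show "dual_apply \<phi> x = dual_apply \<psi> x"
    using pos[of "pprt x"] pos[of "pprt (- x)"] by (metis dual_apply_simps(8) zero_le_pprt)
qed

lemma sup_dual_facts:
  fixes \<phi> \<psi> :: "'a dual" and x :: 'a
  shows "\<phi> \<le> sup \<phi> \<psi>" "\<psi> \<le> sup \<phi> \<psi>" "\<phi> \<le> \<omega> \<Longrightarrow> \<psi> \<le> \<omega> \<Longrightarrow> sup \<phi> \<psi> \<le> \<omega>"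
    and "0 \<le> x \<Longrightarrow> dual_apply (sup \<phi> \<psi>) x = dual_apply \<psi> x + (SUP y\<in>{0..x}. dual_apply (\<phi> - \<psi>) y)"
proof -
  obtain \<eta> where \<eta>: "\<And>x. 0 \<le> x \<Longrightarrow> dual_apply \<eta> x = (SUP y\<in>{0..x}. dual_apply (\<phi> - \<psi>) y)"
    using riesz_kantorovich by blast
  have bdd: "bdd_above (dual_apply (\<phi> - \<psi>) ` {0..x})" for x
  proof (rule bdd_aboveI2)
    fix y assume "y \<in> {0..x}"
    then have "norm (\<phi> - \<psi>) * norm y \<le> norm (\<phi> - \<psi>) * norm x"
      by (intro mult_left_mono norm_mono_nonneg) auto
    then show "dual_apply (\<phi> - \<psi>) y \<le> norm (\<phi> - \<psi>) * norm x"
      using abs_dual_apply_le[of "\<phi> - \<psi>" y] by linarith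
  qed
  have ge: "dual_apply (\<phi> - \<psi>) y \<le> dual_apply \<eta> x" if "0 \<le> y" "y \<le> x" for x y
    using that \<eta>[of x] cSUP_upper[OF _ bdd, of y x] by auto
  have ub1: "\<phi> \<le> \<psi> + \<eta>"
    unfolding less_eq_dual_def using ge by fastforce
  have ub2: "\<psi> \<le> \<psi> + \<eta>"
    unfolding less_eq_dual_def using ge[of 0] by simp
  have least: "\<psi> + \<eta> \<le> \<omega>" if "\<phi> \<le> \<omega>" "\<psi> \<le> \<omega>" for \<omega>
    unfolding less_eq_dual_def
  proof (intro allI impI)
    fix x :: 'a assume x: "0 \<le> x"
    have "(SUP y\<in>{0..x}. dual_apply (\<phi> - \<psi>) y) \<le> dual_apply (\<omega> - \<psi>) x"
    proof (rule cSUP_least)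
      fix y assume y: "y \<in> {0..x}"
      have "dual_apply \<phi> y \<le> dual_apply \<omega> y"
        using that(1) y by (auto simp: less_eq_dual_def)
      moreover have "dual_apply \<psi> (x - y) \<le> dual_apply \<omega> (x - y)"
        using that(2) y by (simp add: less_eq_dual_def del: dual_apply_simps)
      ultimately show "dual_apply (\<phi> - \<psi>) y \<le> dual_apply (\<omega> - \<psi>) x"
        by simp
    qed (use x in auto)
    then show "dual_apply (\<psi> + \<eta>) x \<le> dual_apply \<omega> x"
      by (simp add: \<eta>[OF x])
  qed
  have sup_eq: "sup \<phi> \<psi> = \<psi> + \<eta>"
    unfolding sup_dual_def
    by (rule the_equality) (use ub1 ub2 least dual_order_antisym in blast)+
  show "\<phi> \<le> sup \<phi> \<psi>" "\<psi> \<le> sup \<phi> \<psi>" "\<phi> \<le> \<omega> \<Longrightarrow> \<psi> \<le> \<omega> \<Longrightarrow> sup \<phi> \<psi> \<le> \<omega>"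
    using ub1 ub2 least by (auto simp: sup_eq)
  show "0 \<le> x \<Longrightarrow> dual_apply (sup \<phi> \<psi>) x = dual_apply \<psi> x + (SUP y\<in>{0..x}. dual_apply (\<phi> - \<psi>) y)"
    by (simp add: sup_eq \<eta>)
qed

lemma dual_neg_le_iff: "- \<phi> \<le> - \<psi> \<longleftrightarrow> \<psi> \<le> (\<phi> :: 'a dual)"
  by (simp add: less_eq_dual_def)

lemma abs_dual_le:
  fixes \<phi> :: "'a dual" and x :: 'a
  assumes "0 \<le> x"
  shows "dual_apply \<bar>\<phi>\<bar> x \<le> norm \<phi> * norm x"
proof -
  have "(SUP y\<in>{0..x}. dual_apply (\<phi> - - \<phi>) y) \<le> norm \<phi> * norm x + dual_apply \<phi> x"
  proof (rule cSUP_least)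
    fix y assume y: "y \<in> {0..x}"
    define z where "z = y + y - x"
    have "z \<le> x" "- z \<le> x"
      using y by (auto simp: z_def algebra_simps intro: add_mono)
    then have "norm z \<le> norm x"
      using assms by (intro norm_mono_abs) (simp add: abs_leI)
    then have "norm \<phi> * norm z \<le> norm \<phi> * norm x"
      by (intro mult_left_mono) auto
    then have "dual_apply \<phi> z \<le> norm \<phi> * norm x"
      using abs_dual_apply_le[of \<phi> z] by linarith
    then show "dual_apply (\<phi> - - \<phi>) y \<le> norm \<phi> * norm x + dual_apply \<phi> x"
      by (simp add: z_def)
  qed (use assms in auto)
  then show ?thesis
    using sup_dual_facts(4)[OF assms, of \<phi> "- \<phi>"] by (simp add: abs_dual_def)
qed

lemma abs_apply_le_abs_dual:
  fixes \<phi> :: "'a dual"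
  shows "\<bar>dual_apply \<phi> x\<bar> \<le> dual_apply \<bar>\<phi>\<bar> \<bar>x\<bar>"
proof -
  have *: "dual_apply \<phi> u \<le> dual_apply \<bar>\<phi>\<bar> u" "- dual_apply \<phi> u \<le> dual_apply \<bar>\<phi>\<bar> u"
    if "0 \<le> u" for u
    using sup_dual_facts(1,2)[where \<phi> = \<phi> and \<psi> = "- \<phi>"] that
    by (auto simp: less_eq_dual_def abs_dual_def)
  have "x = pprt x - pprt (- x)" "\<bar>x\<bar> = pprt x + pprt (- x)"
    using prts[of x] by (simp_all add: pprt_neg abs_prts)
  then have "dual_apply \<phi> x = dual_apply \<phi> (pprt x) - dual_apply \<phi> (pprt (- x))"
    "dual_apply \<bar>\<phi>\<bar> \<bar>x\<bar> = dual_apply \<bar>\<phi>\<bar> (pprt x) + dual_apply \<bar>\<phi>\<bar> (pprt (- x))"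
    by (metis dual_apply_simps(8), metis dual_apply_simps(7))
  then show ?thesis
    using *[of "pprt x"] *[of "pprt (- x)"] by simp
qed

instance
proof
  fix \<phi> \<psi> \<omega> :: "'a dual" and a b :: real
  show "\<phi> < \<psi> \<longleftrightarrow> \<phi> \<le> \<psi> \<and> \<not> \<psi> \<le> \<phi>"
    by (rule less_dual_def)
  show "\<phi> \<le> \<phi>"
    by (simp add: less_eq_dual_def)
  show "\<phi> \<le> \<psi> \<Longrightarrow> \<psi> \<le> \<omega> \<Longrightarrow> \<phi> \<le> \<omega>"
    by (meson less_eq_dual_def order_trans)
  show "\<phi> \<le> \<psi> \<Longrightarrow> \<psi> \<le> \<phi> \<Longrightarrow> \<phi> = \<psi>"
    by (rule dual_order_antisym)
  show "\<phi> \<le> \<psi> \<Longrightarrow> \<omega> + \<phi> \<le> \<omega> + \<psi>"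
    by (simp add: less_eq_dual_def)
  show "\<phi> \<le> \<psi> \<Longrightarrow> 0 \<le> a \<Longrightarrow> a *\<^sub>R \<phi> \<le> a *\<^sub>R \<psi>"
    by (simp add: less_eq_dual_def mult_left_mono)
  show "a \<le> b \<Longrightarrow> 0 \<le> \<phi> \<Longrightarrow> a *\<^sub>R \<phi> \<le> b *\<^sub>R \<phi>"
    by (simp add: less_eq_dual_def mult_right_mono)
  show "\<phi> \<le> sup \<phi> \<psi>" "\<psi> \<le> sup \<phi> \<psi>" "\<psi> \<le> \<phi> \<Longrightarrow> \<omega> \<le> \<phi> \<Longrightarrow> sup \<psi> \<omega> \<le> \<phi>"
    by (fact sup_dual_facts)+
  show "inf \<phi> \<psi> \<le> \<phi>" "inf \<phi> \<psi> \<le> \<psi>" "\<phi> \<le> \<psi> \<Longrightarrow> \<phi> \<le> \<omega> \<Longrightarrow> \<phi> \<le> inf \<psi> \<omega>"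
    unfolding inf_dual_def
    by (metis add.inverse_inverse dual_neg_le_iff sup_dual_facts(1-3))+
  show "\<bar>\<phi>\<bar> = sup \<phi> (- \<phi>)"
    by (rule abs_dual_def)
  show "norm \<phi> \<le> norm \<psi>" if "\<bar>\<phi>\<bar> \<le> \<bar>\<psi>\<bar>"
  proof (rule norm_dual_bound)
    fix x
    have "\<bar>dual_apply \<phi> x\<bar> \<le> dual_apply \<bar>\<phi>\<bar> \<bar>x\<bar>"
      by (rule abs_apply_le_abs_dual)
    also have "\<dots> \<le> dual_apply \<bar>\<psi>\<bar> \<bar>x\<bar>"
      using that by (simp add: less_eq_dual_def)
    also have "\<dots> \<le> norm \<psi> * norm \<bar>x\<bar>"
      by (simp add: abs_dual_le)
    also have "norm \<bar>x\<bar> \<le> norm x"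
      by (rule norm_mono_abs) simp
    finally show "\<bar>dual_apply \<phi> x\<bar> \<le> norm \<psi> * norm x"
      by (simp add: mult_left_mono)
  qed simp
qed

end

section \<open>Banach sequence lattices\<close>

text \<open>A space is given by its set of sequences and its norm; the values of the norm outside
  that set are irrelevant. Sequences are indexed from 0.\<close>

record seq_space =
  seqs :: "(nat \<Rightarrow> real) set"
  seq_norm :: "(nat \<Rightarrow> real) \<Rightarrow> real"

definition unit_seq :: "nat \<Rightarrow> nat \<Rightarrow> real"
  where "unit_seq k = (\<lambda>i. if i = k then 1 else 0)"

definition banach_sequence_lattice :: "seq_space \<Rightarrow> bool"
  where "banach_sequence_lattice Y \<longleftrightarrow>
    \<comment> \<open>linear subspace containing the canonical sequences\<close>
    (\<lambda>_. 0) \<in> seqs Y \<and>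
    (\<forall>f\<in>seqs Y. \<forall>g\<in>seqs Y. (\<lambda>i. f i + g i) \<in> seqs Y) \<and>
    (\<forall>c. \<forall>f\<in>seqs Y. (\<lambda>i. c * f i) \<in> seqs Y) \<and>
    (\<forall>k. unit_seq k \<in> seqs Y) \<and>
    \<comment> \<open>norm\<close>
    (\<forall>f\<in>seqs Y. 0 \<le> seq_norm Y f \<and> (seq_norm Y f = 0 \<longleftrightarrow> f = (\<lambda>_. 0))) \<and>
    (\<forall>c. \<forall>f\<in>seqs Y. seq_norm Y (\<lambda>i. c * f i) = \<bar>c\<bar> * seq_norm Y f) \<and>
    (\<forall>f\<in>seqs Y. \<forall>g\<in>seqs Y. seq_norm Y (\<lambda>i. f i + g i) \<le> seq_norm Y f + seq_norm Y g) \<and>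
    \<comment> \<open>completeness\<close>
    (\<forall>F. (\<forall>k. F k \<in> seqs Y) \<and>
      (\<forall>e>0. \<exists>K. \<forall>k\<ge>K. \<forall>l\<ge>K. seq_norm Y (\<lambda>i. F k i - F l i) < e) \<longrightarrow>
      (\<exists>f\<in>seqs Y. (\<lambda>k. seq_norm Y (\<lambda>i. F k i - f i)) \<longlonglongrightarrow> 0)) \<and>
    \<comment> \<open>ideal property\<close>
    (\<forall>f. \<forall>g\<in>seqs Y. (\<forall>i. \<bar>f i\<bar> \<le> \<bar>g i\<bar>) \<longrightarrow> f \<in> seqs Y \<and> seq_norm Y f \<le> seq_norm Y g)"

text \<open>The supremum is a real one: it is only meaningful on \<open>seqs (koethe_space Y)\<close>, where
  the sums are finite and, \<open>Y\<close> being complete, uniformly bounded.\<close>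

definition koethe_space :: "seq_space \<Rightarrow> seq_space"
  where "koethe_space Y =
    \<lparr> seqs = {\<beta>. \<forall>\<alpha>\<in>seqs Y. summable (\<lambda>i. \<bar>\<alpha> i * \<beta> i\<bar>)},
      seq_norm = (\<lambda>\<beta>. SUP \<alpha>\<in>{\<alpha>\<in>seqs Y. seq_norm Y \<alpha> \<le> 1}. \<Sum>i. \<bar>\<alpha> i * \<beta> i\<bar>) \<rparr>"

section \<open>Krivine's functional calculus\<close>

text \<open>\<open>Euclidean_space n\<close> is \<open>\<real>\<^sup>n\<close> realised as the sequences vanishing from index \<open>n\<close> on,
  which is also the identification of finite tuples with elements of a sequence space.
  A function on \<open>\<real>\<^sup>n\<close> is represented by its extension by 0, so that pointwise
  operations stay within the space and distinct elements are distinct functions.\<close>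

definition hom_fun :: "nat \<Rightarrow> ((nat \<Rightarrow> real) \<Rightarrow> real) set"
  where "hom_fun n = {h.
    continuous_map (Euclidean_space n) euclideanreal h \<and>
    (\<forall>t\<in>topspace (Euclidean_space n). \<forall>c\<ge>0. h (\<lambda>i. c * t i) = c * h t) \<and>
    (\<forall>t. t \<notin> topspace (Euclidean_space n) \<longrightarrow> h t = 0)}"

definition on_Rn :: "nat \<Rightarrow> ((nat \<Rightarrow> real) \<Rightarrow> real) \<Rightarrow> (nat \<Rightarrow> real) \<Rightarrow> real"
  where "on_Rn n h = (\<lambda>t. if t \<in> topspace (Euclidean_space n) then h t else 0)"

text \<open>Only the entries \<open>x j\<close> with \<open>j < n\<close> of the tuple \<open>x\<close> matter.\<close>

definition is_krivine_calculus ::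
    "nat \<Rightarrow> (nat \<Rightarrow> 'a::banach_lattice) \<Rightarrow> (((nat \<Rightarrow> real) \<Rightarrow> real) \<Rightarrow> 'a) \<Rightarrow> bool"
  where "is_krivine_calculus n x \<tau> \<longleftrightarrow>
    (\<forall>h\<in>hom_fun n. \<forall>k\<in>hom_fun n. \<tau> (\<lambda>t. h t + k t) = \<tau> h + \<tau> k) \<and>
    (\<forall>c. \<forall>h\<in>hom_fun n. \<tau> (\<lambda>t. c * h t) = c *\<^sub>R \<tau> h) \<and>
    (\<forall>j<n. \<tau> (on_Rn n (\<lambda>t. t j)) = x j) \<and>
    (\<forall>h\<in>hom_fun n. \<forall>k\<in>hom_fun n. \<tau> (\<lambda>t. max (h t) (k t)) = sup (\<tau> h) (\<tau> k))"

definition krivine ::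
    "nat \<Rightarrow> (nat \<Rightarrow> 'a::banach_lattice) \<Rightarrow> ((nat \<Rightarrow> real) \<Rightarrow> real) \<Rightarrow> 'a"
  where "krivine n x = (THE \<tau>. \<tau> \<in> extensional (hom_fun n) \<and> is_krivine_calculus n x \<tau>)"

definition tuple_norm :: "seq_space \<Rightarrow> nat \<Rightarrow> (nat \<Rightarrow> 'a::banach_lattice) \<Rightarrow> 'a"
  where "tuple_norm Y n x = krivine n x (on_Rn n (seq_norm Y))"

end

theory Submission
  imports Defs
begin

text \<open>By homogeneity one may work on the unit sphere of \<open>u(t) = \<Sum>j. |t j|\<close>. A partition of unity
  \<open>e i\<close> there, subordinate to points \<open>a i\<close>, approximates every \<open>h\<close> by \<open>\<Sum>i. h (a i) e i\<close> up to \<open>\<epsilon> u\<close>.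
  Write \<open>\<tau>\<close> for the calculus at \<open>x\<close> and \<open>\<rho>\<close> for the one at \<open>\<phi>\<close>. Up to small errors \<open>x j\<close> is
  \<open>\<Sum>i. a i j \<tau>(e i)\<close>, so \<open>\<Sum>j. \<plusminus>\<phi> j (x j)\<close> is \<open>\<Sum>i. (\<Sum>j. \<plusminus>a i j \<phi> j) (\<tau>(e i))\<close>. By Hoelder's inequality in
  \<open>\<real>\<^sup>n\<close> and positivity of \<open>\<rho>\<close>, the functional in brackets is at most the Y-norm of \<open>a i\<close> times
  the Koethe norm of \<open>\<phi>\<close>, and summing over \<open>i\<close> recovers the Y-norm of \<open>x\<close>.

  As the calculus is a definite description, it must be constructed. Every function in the
  vector lattice generated by the coordinates is a difference of maxima of linear forms, and
  Gordan's alternative turns a pointwise inequality between such maxima into one in the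
  lattice. The partition of unity can be chosen piecewise linear, so this vector lattice is
  dense, and the calculus extends to all of \<open>hom_fun n\<close> by completeness.\<close>

abbreviation Rn :: "nat \<Rightarrow> (nat \<Rightarrow> real) set"
  where "Rn n \<equiv> topspace (Euclidean_space n)"

lemma Rn_iff: "t \<in> Rn n \<longleftrightarrow> (\<forall>i\<ge>n. t i = 0)"
  by (simp add: topspace_Euclidean_space)

section \<open>Comparing sublinear expressions in a vector lattice\<close>

text \<open>The point of least Euclidean norm in the convex hull of the \<open>v a\<close> must be the origin,
  since otherwise its negative violates the hypothesis.\<close>

lemma gordan:
  fixes v :: "'i \<Rightarrow> nat \<Rightarrow> real"
  assumes "finite A" and ex: "\<And>t. t \<in> Rn n \<Longrightarrow> \<exists>a\<in>A. 0 \<le> (\<Sum>j<n. v a j * t j)"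
  obtains w where "\<And>a. a \<in> A \<Longrightarrow> 0 \<le> w a" "sum w A = 1"
    "\<And>j. j < n \<Longrightarrow> (\<Sum>a\<in>A. w a * v a j) = 0"
proof -
  \<comment> \<open>The simplex of weights. Coordinates outside \<open>A\<close> stay free in the
    unit interval, so that \<open>S\<close> is closed in a product of compact intervals over the
    whole index type.\<close>
  define S where "S = PiE UNIV (\<lambda>_::'i. {0..1::real}) \<inter> {w. sum w A = 1}"
  define p where "p w j = (\<Sum>a\<in>A. w a * v a j)" for w :: "'i \<Rightarrow> real" and j
  have coord: "continuous_on U (\<lambda>w::'i \<Rightarrow> real. w a)" for U a
    by (rule continuous_on_subset[OF continuous_on_product_coordinates]) simp
  have cp: "continuous_on U (\<lambda>w. p w j)" for j U
    unfolding p_def by (intro continuous_intros coord)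
  have "compact (PiE UNIV (\<lambda>_::'i. {0..1::real}))"
    using compactin_PiE[of "\<lambda>_::'i. euclideanreal" UNIV "\<lambda>_. {0..1}"]
    by (simp add: euclidean_product_topology)
  moreover have "closed {w :: 'i \<Rightarrow> real. sum w A = 1}"
    by (intro closed_Collect_eq continuous_intros coord)
  ultimately have "compact S"
    unfolding S_def by (rule compact_Int_closed)
  obtain a0 where a0: "a0 \<in> A"
    using ex[of "\<lambda>_. 0"] by (auto simp: Rn_iff)
  then have "(\<lambda>a. if a = a0 then 1 else 0) \<in> S"
    using assms(1) by (auto simp: S_def)
  then have "S \<noteq> {}"
    by blast
  moreover have "continuous_on S (\<lambda>w. \<Sum>j<n. (p w j)\<^sup>2)"
    by (intro continuous_intros cp)
  ultimately obtain w where w: "w \<in> S"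
    and min: "\<And>w'. w' \<in> S \<Longrightarrow> (\<Sum>j<n. (p w j)\<^sup>2) \<le> (\<Sum>j<n. (p w' j)\<^sup>2)"
    using continuous_attains_inf[OF \<open>compact S\<close>] by meson
  have w0: "0 \<le> w a" "w a \<le> 1" for a
    using w by (auto simp: S_def PiE_iff)
  have w1: "sum w A = 1"
    using w by (simp add: S_def)
  \<comment> \<open>The variational inequality at the minimiser: moving \<open>w\<close> by
    \<open>s\<close> towards the vertex \<open>b\<close> changes the squared norm by
    \<open>2 * s * d + s\<^sup>2 * q\<close>, which would be negative for small \<open>s\<close> if
    \<open>d\<close> were negative.\<close>
  have ge: "(\<Sum>j<n. (p w j)\<^sup>2) \<le> (\<Sum>j<n. p w j * v b j)" if b: "b \<in> A" for b
  proof (rule ccontr)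
    define d where "d = (\<Sum>j<n. p w j * (v b j - p w j))"
    define q where "q = (\<Sum>j<n. (v b j - p w j)\<^sup>2)"
    assume "\<not> ?thesis"
    then have "d < 0"
      by (simp add: d_def sum_subtractf right_diff_distrib power2_eq_square)
    have "0 \<le> q"
      by (simp add: q_def sum_nonneg)
    have key: "0 \<le> 2 * d + s * q" if s: "0 < s" "s \<le> 1" for s
    proof -
      define w' where "w' a = (1 - s) * w a + s * (if a = b then 1 else 0)" for a
      have "0 \<le> w' a \<and> w' a \<le> 1" for a
        using s w0[of a] convex_bound_le[of "w a" 1 "if a = b then 1 else 0" "1 - s" s]
        by (auto simp: w'_def intro!: add_nonneg_nonneg)
      moreover have "sum w' A = 1"
        using b assms(1) w1
        by (simp add: w'_def sum.distrib flip: sum_distrib_left)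
      ultimately have "w' \<in> S"
        by (simp add: S_def PiE_iff)
      have p': "p w' j = p w j + s * (v b j - p w j)" for j
      proof -
        have "p w' j = (\<Sum>a\<in>A. (1 - s) * (w a * v a j)) + (\<Sum>a\<in>A. if a = b then s * v a j else 0)"
          unfolding p_def w'_def sum.distrib[symmetric]
          by (intro sum.cong) (auto simp: algebra_simps)
        also have "\<dots> = (1 - s) * p w j + s * v b j"
          using b assms(1) by (simp add: p_def sum_distrib_left)
        finally show ?thesis
          by (simp add: algebra_simps)
      qed
      have "(\<Sum>j<n. (p w' j)\<^sup>2) = (\<Sum>j<n. (p w j)\<^sup>2) + 2 * s * d + s\<^sup>2 * q"
        by (simp add: p' d_def q_def power2_eq_square algebra_simps sum.distrib sum_subtractf
            sum_distrib_left)
      with min[OF \<open>w' \<in> S\<close>] have "0 \<le> s * (2 * d + s * q)"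
        by (simp add: power2_eq_square algebra_simps)
      with s show ?thesis
        by (simp add: zero_le_mult_iff)
    qed
    \<comment> \<open>The bound 1 keeps \<open>w'\<close> in the simplex, and the quotient gives
      \<open>s * q \<le> - d\<close>, hence \<open>2 * d + s * q \<le> d < 0\<close>. The summand 1
      covers \<open>q = 0\<close>.\<close>
    define s where "s = min 1 (- d / (q + 1))"
    have "0 < s" "s \<le> 1"
      using \<open>d < 0\<close> \<open>0 \<le> q\<close> by (auto simp: s_def intro: divide_neg_pos)
    have "s * q \<le> s * (q + 1)"
      using \<open>0 < s\<close> by simp
    also have "\<dots> \<le> (- d / (q + 1)) * (q + 1)"
      using \<open>0 \<le> q\<close> by (intro mult_right_mono) (auto simp: s_def)
    also have "\<dots> = - d"
      using \<open>0 \<le> q\<close> by simp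
    finally show False
      using key[OF \<open>0 < s\<close> \<open>s \<le> 1\<close>] \<open>d < 0\<close> by simp
  qed
  \<comment> \<open>The negative of the minimiser: the hypothesis yields a \<open>b\<close> whose
    inner product with \<open>p w\<close> is at most 0, while \<open>ge\<close> bounds that product
    below by the squared norm.\<close>
  define t where "t j = (if j < n then - p w j else 0)" for j
  have "t \<in> Rn n"
    by (simp add: Rn_iff t_def)
  then obtain b where b: "b \<in> A" "0 \<le> (\<Sum>j<n. v b j * t j)"
    using ex by blast
  have "(\<Sum>j<n. v b j * t j) = - (\<Sum>j<n. p w j * v b j)"
    by (simp add: t_def sum_negf mult.commute)
  with b ge[OF b(1)] have "(\<Sum>j<n. (p w j)\<^sup>2) \<le> 0"
    by simp
  then have "(\<Sum>j<n. (p w j)\<^sup>2) = 0"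
    by (simp add: antisym sum_nonneg)
  then have "p w j = 0" if "j < n" for j
    using that by (simp add: sum_nonneg_eq_0_iff)
  with w0(1) w1 show thesis
    by (intro that[of w]) (auto simp: p_def)
qed

text \<open>As a relation this applies to the same finite family of linear forms both in the reals
  and in the lattice, without ordering the family into an iterated binary supremum.\<close>

definition is_lub :: "'b::order set \<Rightarrow> 'b \<Rightarrow> bool"
  where "is_lub S y \<longleftrightarrow> (\<forall>s\<in>S. s \<le> y) \<and> (\<forall>z. (\<forall>s\<in>S. s \<le> z) \<longrightarrow> y \<le> z)"

text \<open>Translations preserve the order: an upper bound \<open>u\<close> of all sums gives
  \<open>y \<le> u - t\<close> for each \<open>t\<close> in \<open>T\<close>, and then
  \<open>z \<le> u - y\<close>.\<close>

lemma is_lub_add: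
  fixes y z :: "'b::ordered_ab_group_add"
  assumes "is_lub S y" "is_lub T z"
  shows "is_lub ((\<lambda>(s, t). s + t) ` (S \<times> T)) (y + z)"
  unfolding is_lub_def
proof (intro conjI allI impI)
  show "\<forall>s\<in>(\<lambda>(s, t). s + t) ` (S \<times> T). s \<le> y + z"
    using assms by (auto simp: is_lub_def intro: add_mono)
  fix u assume u: "\<forall>s\<in>(\<lambda>(s, t). s + t) ` (S \<times> T). s \<le> u"
  have "y \<le> u - t" if "t \<in> T" for t
  proof -
    have "s \<le> u - t" if "s \<in> S" for s
      using u that \<open>t \<in> T\<close> by (auto simp: le_diff_eq)
    then show ?thesis
      using assms(1) by (auto simp: is_lub_def)
  qed
  then have "z \<le> u - y"
    using assms(2) unfolding is_lub_def by (metis le_diff_eq add.commute)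
  then show "y + z \<le> u"
    by (simp add: le_diff_eq add.commute)
qed

lemma is_lub_scaleR:
  fixes y :: "'b::ordered_real_vector"
  assumes "is_lub S y" "0 < c"
  shows "is_lub ((*\<^sub>R) c ` S) (c *\<^sub>R y)"
  unfolding is_lub_def
proof (intro conjI allI impI)
  show "\<forall>s\<in>(*\<^sub>R) c ` S. s \<le> c *\<^sub>R y"
    using assms by (auto simp: is_lub_def intro!: scaleR_left_mono)
  fix z assume z: "\<forall>s\<in>(*\<^sub>R) c ` S. s \<le> z"
  have "s \<le> inverse c *\<^sub>R z" if "s \<in> S" for s
    using scaleR_left_mono[of "c *\<^sub>R s" z "inverse c"] z that assms(2) by auto
  then have "y \<le> inverse c *\<^sub>R z"
    using assms(1) by (auto simp: is_lub_def)
  then show "c *\<^sub>R y \<le> z"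
    using scaleR_left_mono[of y "inverse c *\<^sub>R z" c] assms(2) by auto
qed

lemma is_lub_Un:
  fixes y z :: "'b::lattice"
  assumes "is_lub S y" "is_lub T z"
  shows "is_lub (S \<union> T) (sup y z)"
  using assms unfolding is_lub_def by (auto intro: le_supI1 le_supI2)

definition lincomb :: "nat \<Rightarrow> (nat \<Rightarrow> real) \<Rightarrow> (nat \<Rightarrow> 'b::real_vector) \<Rightarrow> 'b"
  where "lincomb n a x = (\<Sum>j<n. a j *\<^sub>R x j)"

text \<open>Pairs consisting of a maximum of finitely many linear forms and the same
  expression evaluated at \<open>x\<close>.\<close>

definition sublin_graph ::
    "nat \<Rightarrow> (nat \<Rightarrow> 'a::banach_lattice) \<Rightarrow> (((nat \<Rightarrow> real) \<Rightarrow> real) \<times> 'a) set"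
  where "sublin_graph n x = {(h, y). \<exists>A. finite A \<and> A \<noteq> {} \<and>
    (\<forall>t. is_lub ((\<lambda>a. lincomb n a t) ` A) (h t)) \<and> is_lub ((\<lambda>a. lincomb n a x) ` A) y}"

lemma sublin_graph_lincomb: "(\<lambda>t. lincomb n a t, lincomb n a x) \<in> sublin_graph n x"
  unfolding sublin_graph_def by (auto simp: is_lub_def intro!: exI[of _ "{a}"])

lemma sublin_graph_add:
  assumes "(h, y) \<in> sublin_graph n x" "(k, z) \<in> sublin_graph n x"
  shows "(\<lambda>t. h t + k t, y + z) \<in> sublin_graph n x"
proof -
  obtain A B where A: "finite A" "A \<noteq> {}"
      "\<And>t. is_lub ((\<lambda>a. lincomb n a t) ` A) (h t)" "is_lub ((\<lambda>a. lincomb n a x) ` A) y"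
    and B: "finite B" "B \<noteq> {}"
      "\<And>t. is_lub ((\<lambda>a. lincomb n a t) ` B) (k t)" "is_lub ((\<lambda>a. lincomb n a x) ` B) z"
    using assms unfolding sublin_graph_def by blast
  define C where "C = (\<lambda>(a, b) j. a j + b j) ` (A \<times> B)"
  have img: "(\<lambda>a. lincomb n a u) ` C
      = (\<lambda>(s, t). s + t) ` ((\<lambda>a. lincomb n a u) ` A \<times> (\<lambda>a. lincomb n a u) ` B)"
    for u :: "nat \<Rightarrow> 'b::real_vector"
    by (force simp: C_def lincomb_def scaleR_add_left sum.distrib)
  have "finite C" "C \<noteq> {}"
    using A B by (auto simp: C_def)
  moreover have "is_lub ((\<lambda>a. lincomb n a t) ` C) (h t + k t)" for t
    unfolding img using A(3) B(3) by (rule is_lub_add)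
  moreover have "is_lub ((\<lambda>a. lincomb n a x) ` C) (y + z)"
    unfolding img using A(4) B(4) by (rule is_lub_add)
  ultimately show ?thesis
    unfolding sublin_graph_def by blast
qed

lemma sublin_graph_scale:
  assumes "(h, y) \<in> sublin_graph n x" "0 < c"
  shows "(\<lambda>t. c * h t, c *\<^sub>R y) \<in> sublin_graph n x"
proof -
  obtain A where A: "finite A" "A \<noteq> {}"
      "\<And>t. is_lub ((\<lambda>a. lincomb n a t) ` A) (h t)" "is_lub ((\<lambda>a. lincomb n a x) ` A) y"
    using assms unfolding sublin_graph_def by blast
  define C where "C = (\<lambda>a j. c * a j) ` A"
  have img: "(\<lambda>a. lincomb n a u) ` C = (*\<^sub>R) c ` (\<lambda>a. lincomb n a u) ` A"
    for u :: "nat \<Rightarrow> 'b::real_vector"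
    by (force simp: C_def lincomb_def scaleR_sum_right)
  have "finite C" "C \<noteq> {}"
    using A by (auto simp: C_def)
  moreover have "is_lub ((\<lambda>a. lincomb n a t) ` C) (c * h t)" for t
    using is_lub_scaleR[OF A(3) assms(2)] by (simp add: img)
  moreover have "is_lub ((\<lambda>a. lincomb n a x) ` C) (c *\<^sub>R y)"
    unfolding img using A(4) assms(2) by (rule is_lub_scaleR)
  ultimately show ?thesis
    unfolding sublin_graph_def by blast
qed

lemma sublin_graph_sup:
  assumes "(h, y) \<in> sublin_graph n x" "(k, z) \<in> sublin_graph n x"
  shows "(\<lambda>t. max (h t) (k t), sup y z) \<in> sublin_graph n x"
proof -
  obtain A B where A: "finite A" "A \<noteq> {}"
      "\<And>t. is_lub ((\<lambda>a. lincomb n a t) ` A) (h t)" "is_lub ((\<lambda>a. lincomb n a x) ` A) y"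
    and B: "finite B" "B \<noteq> {}"
      "\<And>t. is_lub ((\<lambda>a. lincomb n a t) ` B) (k t)" "is_lub ((\<lambda>a. lincomb n a x) ` B) z"
    using assms unfolding sublin_graph_def by blast
  have "is_lub ((\<lambda>a. lincomb n a t) ` (A \<union> B)) (max (h t) (k t))" for t
    using is_lub_Un[OF A(3) B(3)] by (simp add: image_Un sup_max)
  moreover have "is_lub ((\<lambda>a. lincomb n a x) ` (A \<union> B)) (sup y z)"
    using is_lub_Un[OF A(4) B(4)] by (simp add: image_Un)
  ultimately show ?thesis
    using A B unfolding sublin_graph_def by (auto intro!: exI[of _ "A \<union> B"])
qed

text \<open>If a maximum of linear forms dominates a form \<open>a\<close> pointwise, then Gordan's
  alternative, applied to the differences \<open>b - a\<close>, makes \<open>a\<close> a convex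
  combination of the forms in \<open>B\<close>. That identity can be evaluated at \<open>x\<close>,
  and a convex combination of elements below \<open>z\<close> is below \<open>z\<close>.\<close>

lemma sublin_graph_mono:
  assumes "(h, y) \<in> sublin_graph n x" "(k, z) \<in> sublin_graph n x"
    and le: "\<And>t. t \<in> Rn n \<Longrightarrow> h t \<le> k t"
  shows "y \<le> z"
proof -
  obtain A B where A: "finite A" "A \<noteq> {}"
      "\<And>t. is_lub ((\<lambda>a. lincomb n a t) ` A) (h t)" "is_lub ((\<lambda>a. lincomb n a x) ` A) y"
    and B: "finite B" "B \<noteq> {}"
      "\<And>t. is_lub ((\<lambda>a. lincomb n a t) ` B) (k t)" "is_lub ((\<lambda>a. lincomb n a x) ` B) z"
    using assms unfolding sublin_graph_def by blast
  have "lincomb n a x \<le> z" if "a \<in> A" for a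
  proof -
    have "\<exists>b\<in>B. 0 \<le> (\<Sum>j<n. (b j - a j) * t j)" if t: "t \<in> Rn n" for t
    proof (rule ccontr)
      assume neg: "\<not> ?thesis"
      \<comment> \<open>In the reals the supremum over the finite set \<open>B\<close> is attained,
        so some single form \<open>b\<close> is at least \<open>k t\<close>, hence at least
        \<open>lincomb n a t\<close>.\<close>
      have "Max ((\<lambda>b. lincomb n b t) ` B) \<in> (\<lambda>b. lincomb n b t) ` B"
        using B(1,2) by (intro Max_in) auto
      then obtain b where b: "b \<in> B" "Max ((\<lambda>b. lincomb n b t) ` B) = lincomb n b t"
        by blast
      have "lincomb n c t \<le> lincomb n b t" if "c \<in> B" for c
        unfolding b(2)[symmetric] using B(1) that by (intro Max_ge) auto
      then have "k t \<le> lincomb n b t"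
        using B(3)[of t] by (auto simp: is_lub_def)
      moreover have "lincomb n a t \<le> h t"
        using A(3)[of t] \<open>a \<in> A\<close> by (auto simp: is_lub_def)
      ultimately have "lincomb n a t \<le> lincomb n b t"
        using le[OF t] by simp
      with neg b(1) show False
        by (auto simp: lincomb_def left_diff_distrib sum_subtractf)
    qed
    then obtain w where w: "\<And>b. b \<in> B \<Longrightarrow> 0 \<le> w b" "sum w B = 1"
        "\<And>j. j < n \<Longrightarrow> (\<Sum>b\<in>B. w b * (b j - a j)) = 0"
      using gordan[OF B(1), of n "\<lambda>b j. b j - a j"] by blast
    have a: "a j = (\<Sum>b\<in>B. w b * b j)" if "j < n" for j
      using w(3)[OF that] w(2)
      by (simp add: right_diff_distrib sum_subtractf flip: sum_distrib_right)
    have "lincomb n a x = (\<Sum>j<n. \<Sum>b\<in>B. w b *\<^sub>R b j *\<^sub>R x j)"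
      by (simp add: lincomb_def a scaleR_sum_left)
    also have "\<dots> = (\<Sum>b\<in>B. w b *\<^sub>R lincomb n b x)"
      by (subst sum.swap) (simp add: lincomb_def scaleR_sum_right)
    also have "\<dots> \<le> (\<Sum>b\<in>B. w b *\<^sub>R z)"
      using B(4) w(1) by (intro sum_mono scaleR_left_mono) (auto simp: is_lub_def)
    also have "\<dots> = z"
      using w(2) by (simp flip: scaleR_sum_left)
    finally show ?thesis .
  qed
  with A(4) show ?thesis
    by (auto simp: is_lub_def)
qed

section \<open>Krivine's calculus on piecewise linear functions\<close>

text \<open>A relation, because one function arises from many lattice-linear expressions. That the
  value depends only on the function follows from \<open>calc_graph_mono\<close>.\<close>

inductive calc_graph ::
    "nat \<Rightarrow> (nat \<Rightarrow> 'a::banach_lattice) \<Rightarrow> ((nat \<Rightarrow> real) \<Rightarrow> real) \<Rightarrow> 'a \<Rightarrow> bool"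
  for n x where
  zero: "calc_graph n x (\<lambda>_. 0) 0"
| proj: "j < n \<Longrightarrow> calc_graph n x (on_Rn n (\<lambda>t. t j)) (x j)"
| add: "calc_graph n x h y \<Longrightarrow> calc_graph n x k z \<Longrightarrow> calc_graph n x (\<lambda>t. h t + k t) (y + z)"
| scale: "calc_graph n x h y \<Longrightarrow> calc_graph n x (\<lambda>t. c * h t) (c *\<^sub>R y)"
| sup: "calc_graph n x h y \<Longrightarrow> calc_graph n x k z \<Longrightarrow>
    calc_graph n x (\<lambda>t. max (h t) (k t)) (sup y z)"

text \<open>Differences of sublinear expressions are closed under maxima, since
  \<open>max (h1 - h2) (k1 - k2)\<close> equals \<open>max (h1 + k2) (k1 + h2) - (h2 + k2)\<close>
  in the reals and likewise in the lattice. A negative scalar exchanges minuend and subtrahend.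
  Equality is claimed on \<open>Rn n\<close> only, because linear forms do not vanish outside
  it.\<close>

lemma calc_graph_normal_form:
  assumes "calc_graph n x h y"
  shows "\<exists>h1 y1 h2 y2. (h1, y1) \<in> sublin_graph n x \<and> (h2, y2) \<in> sublin_graph n x \<and>
    (\<forall>t\<in>Rn n. h t = h1 t - h2 t) \<and> y = y1 - y2"
  using assms
proof induction
  case zero
  show ?case
    by (intro exI conjI) (rule sublin_graph_lincomb, rule sublin_graph_lincomb, auto)
next
  case (proj j)
  have "(\<Sum>i<n. (if i = j then 1 else 0) *\<^sub>R u i) = u j" for u :: "nat \<Rightarrow> 'b::real_vector"
    using proj by (simp add: if_distrib[of "\<lambda>c. c *\<^sub>R _"] sum.delta cong: if_cong)
  then have 1: "lincomb n (\<lambda>i. if i = j then 1 else 0) u = u j" for u :: "nat \<Rightarrow> 'b::real_vector"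
    by (simp add: lincomb_def)
  have 0: "lincomb n (\<lambda>_. 0) u = 0" for u :: "nat \<Rightarrow> 'b::real_vector"
    by (simp add: lincomb_def)
  show ?case
    by (intro exI conjI)
      (rule sublin_graph_lincomb[of n "\<lambda>i. if i = j then 1 else 0" x],
        rule sublin_graph_lincomb[of n "\<lambda>_. 0" x], auto simp: on_Rn_def 0 1)
next
  case (add h y k z)
  then obtain h1 y1 h2 y2 k1 z1 k2 z2 where
    "(h1, y1) \<in> sublin_graph n x" "(h2, y2) \<in> sublin_graph n x"
    "(k1, z1) \<in> sublin_graph n x" "(k2, z2) \<in> sublin_graph n x"
    and eq: "\<forall>t\<in>Rn n. h t = h1 t - h2 t" "y = y1 - y2"
      "\<forall>t\<in>Rn n. k t = k1 t - k2 t" "z = z1 - z2"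
    by blast
  then have "(\<lambda>t. h1 t + k1 t, y1 + z1) \<in> sublin_graph n x"
    "(\<lambda>t. h2 t + k2 t, y2 + z2) \<in> sublin_graph n x"
    by (blast intro: sublin_graph_add)+
  then show ?case
    by (intro exI conjI) (assumption, assumption, auto simp: eq)
next
  case (scale h y c)
  then obtain h1 y1 h2 y2 where
    g: "(h1, y1) \<in> sublin_graph n x" "(h2, y2) \<in> sublin_graph n x"
    and eq: "\<forall>t\<in>Rn n. h t = h1 t - h2 t" "y = y1 - y2"
    by blast
  show ?case
  proof (cases c "0::real" rule: linorder_cases)
    case less
    then have "(\<lambda>t. - c * h1 t, - c *\<^sub>R y1) \<in> sublin_graph n x"
      "(\<lambda>t. - c * h2 t, - c *\<^sub>R y2) \<in> sublin_graph n x"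
      using g by (intro sublin_graph_scale; simp)+
    then show ?thesis
      by (intro exI conjI) (assumption+, auto simp: eq algebra_simps)
  next
    case equal
    then show ?thesis
      by (intro exI conjI) (rule sublin_graph_lincomb, rule sublin_graph_lincomb, auto)
  next
    case greater
    then have "(\<lambda>t. c * h1 t, c *\<^sub>R y1) \<in> sublin_graph n x"
      "(\<lambda>t. c * h2 t, c *\<^sub>R y2) \<in> sublin_graph n x"
      using g by (intro sublin_graph_scale; simp)+
    then show ?thesis
      by (intro exI conjI) (assumption, assumption, auto simp: eq algebra_simps)
  qed
next
  case (sup h y k z)
  then obtain h1 y1 h2 y2 k1 z1 k2 z2 where
    g: "(h1, y1) \<in> sublin_graph n x" "(h2, y2) \<in> sublin_graph n x"
    "(k1, z1) \<in> sublin_graph n x" "(k2, z2) \<in> sublin_graph n x"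
    and eq: "\<forall>t\<in>Rn n. h t = h1 t - h2 t" "y = y1 - y2"
      "\<forall>t\<in>Rn n. k t = k1 t - k2 t" "z = z1 - z2"
    by blast
  have "(\<lambda>t. max (h1 t + k2 t) (k1 t + h2 t), sup (y1 + z2) (z1 + y2)) \<in> sublin_graph n x"
    "(\<lambda>t. h2 t + k2 t, y2 + z2) \<in> sublin_graph n x"
    using g by (auto intro!: sublin_graph_sup sublin_graph_add)
  moreover have "sup y z = sup (y1 + z2) (z1 + y2) - (y2 + z2)"
    using add_sup_distrib_right[of "y1 + z2" "z1 + y2" "- (y2 + z2)"]
    by (simp add: eq algebra_simps)
  moreover have "\<forall>t\<in>Rn n. max (h t) (k t) = max (h1 t + k2 t) (k1 t + h2 t) - (h2 t + k2 t)"
    using eq by auto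
  ultimately show ?case
    by blast
qed

text \<open>Moving the subtrahends to the other side turns the inequality into one between sublinear
  expressions. Used in both directions, it shows that \<open>calc_graph\<close> is
  single-valued.\<close>

lemma calc_graph_mono:
  assumes "calc_graph n x h y" "calc_graph n x k z"
    and le: "\<And>t. t \<in> Rn n \<Longrightarrow> h t \<le> k t"
  shows "y \<le> z"
proof -
  obtain h1 y1 h2 y2 k1 z1 k2 z2 where
    g: "(h1, y1) \<in> sublin_graph n x" "(h2, y2) \<in> sublin_graph n x"
    "(k1, z1) \<in> sublin_graph n x" "(k2, z2) \<in> sublin_graph n x"
    and eq: "\<forall>t\<in>Rn n. h t = h1 t - h2 t" "y = y1 - y2"
      "\<forall>t\<in>Rn n. k t = k1 t - k2 t" "z = z1 - z2"
    using calc_graph_normal_form assms(1,2) by metis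
  have "y1 + z2 \<le> z1 + y2"
    using sublin_graph_add[OF g(1,4)] sublin_graph_add[OF g(3,2)]
  proof (rule sublin_graph_mono)
    fix t assume "t \<in> Rn n"
    then show "h1 t + k2 t \<le> k1 t + h2 t"
      using le[of t] eq(1,3) by auto
  qed
  then show ?thesis
    by (simp add: eq algebra_simps)
qed

lemma calc_graph_diff:
  assumes "calc_graph n x h y" "calc_graph n x k z"
  shows "calc_graph n x (\<lambda>t. h t - k t) (y - z)"
  using calc_graph.add[OF assms(1) calc_graph.scale[OF assms(2), of "-1"]] by simp

lemma calc_graph_abs:
  assumes "calc_graph n x h y"
  shows "calc_graph n x (\<lambda>t. \<bar>h t\<bar>) \<bar>y\<bar>"
proof -
  have "\<bar>h t\<bar> = max (h t) (- 1 * h t)" for t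
    by auto
  then show ?thesis
    using calc_graph.sup[OF assms calc_graph.scale[OF assms, of "-1"]]
    by (simp add: abs_lattice)
qed

lemma calc_graph_min:
  assumes "calc_graph n x h y" "calc_graph n x k z"
  shows "\<exists>w. calc_graph n x (\<lambda>t. min (h t) (k t)) w"
proof -
  have "min (h t) (k t) = h t + k t - max (h t) (k t)" for t
    by auto
  then show ?thesis
    using calc_graph_diff[OF calc_graph.add[OF assms] calc_graph.sup[OF assms]] by auto
qed

lemma calc_graph_sum:
  assumes "\<And>i. i \<in> I \<Longrightarrow> calc_graph n x (h i) (y i)"
  shows "calc_graph n x (\<lambda>t. \<Sum>i\<in>I. h i t) (\<Sum>i\<in>I. y i)"
  using assms
proof (induction I rule: infinite_finite_induct)
  case (insert i I)
  then show ?case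
    by (simp add: calc_graph.add)
qed (simp_all add: calc_graph.zero)

text \<open>The l1 norm, extended by 0. It serves as order unit: approximation errors are measured
  in multiples of it, and its value at \<open>x\<close>, the sum of the
  \<open>\<bar>x j\<bar>\<close>, turns them into norm bounds.\<close>

definition unit_fun :: "nat \<Rightarrow> (nat \<Rightarrow> real) \<Rightarrow> real"
  where "unit_fun n t = (\<Sum>j<n. \<bar>on_Rn n (\<lambda>t. t j) t\<bar>)"

lemma calc_graph_unit_fun: "calc_graph n x (unit_fun n) (\<Sum>j<n. \<bar>x j\<bar>)"
  unfolding unit_fun_def[abs_def] by (auto intro!: calc_graph_sum calc_graph_abs calc_graph.proj)

lemma unit_fun_Rn: "t \<in> Rn n \<Longrightarrow> unit_fun n t = (\<Sum>j<n. \<bar>t j\<bar>)"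
  by (simp add: unit_fun_def on_Rn_def)

lemma unit_fun_nonneg: "0 \<le> unit_fun n t"
  by (simp add: unit_fun_def sum_nonneg)

lemma coord_le_unit_fun:
  assumes "t \<in> Rn n"
  shows "\<bar>t j\<bar> \<le> unit_fun n t"
proof (cases "j < n")
  case True
  then show ?thesis
    using member_le_sum[of j "{..<n}" "\<lambda>j. \<bar>t j\<bar>"] assms by (simp add: unit_fun_Rn)
next
  case False
  with assms show ?thesis
    by (simp add: Rn_iff unit_fun_nonneg)
qed

lemma norm_abs_banach_lattice [simp]: "norm \<bar>y\<bar> = norm (y :: 'a::banach_lattice)"
  by (rule antisym; rule norm_mono_abs) simp_all

text \<open>Continuity of the calculus, obtained from positivity and monotonicity of the lattice
  norm. It is what permits the extension to limits.\<close>

lemma calc_graph_norm_le: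
  fixes x :: "nat \<Rightarrow> 'a::banach_lattice"
  assumes "calc_graph n x h y" "calc_graph n x k z" "0 \<le> c"
    and le: "\<And>t. t \<in> Rn n \<Longrightarrow> \<bar>h t - k t\<bar> \<le> c * unit_fun n t"
  shows "norm (y - z) \<le> c * norm (\<Sum>j<n. \<bar>x j\<bar>)"
proof -
  let ?U = "\<Sum>j<n. \<bar>x j\<bar>"
  have "\<bar>y - z\<bar> \<le> c *\<^sub>R ?U"
    using le by (intro calc_graph_mono[OF calc_graph_abs[OF calc_graph_diff[OF assms(1,2)]]
          calc_graph.scale[OF calc_graph_unit_fun]])
  moreover have "0 \<le> c *\<^sub>R ?U"
    using assms(3) by (intro scaleR_nonneg_nonneg sum_nonneg) auto
  ultimately have "norm (y - z) \<le> norm (c *\<^sub>R ?U)"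
    by (intro norm_mono_abs) simp
  then show ?thesis
    using assms(3) by simp
qed

section \<open>A piecewise linear partition of unity\<close>

text \<open>The nodes fill the cube and need not lie on the l1 sphere: they only have to be finitely
  many, bounded and close to every point of the sphere.\<close>

definition grid :: "nat \<Rightarrow> nat \<Rightarrow> (nat \<Rightarrow> real) set"
  where "grid n m = (\<lambda>k j. if j < n then real_of_int (k j) / real m else 0) `
    PiE {..<n} (\<lambda>_. {- int m..int m})"

lemma Rn_cube_grid:
  assumes "0 < m" "t \<in> Rn n" "\<And>j. \<bar>t j\<bar> \<le> 1"
  obtains a where "a \<in> grid n m"
    "(\<Sum>j<n. \<bar>t j - a j\<bar>) \<le> real n / real m"
proof
  define k where "k = restrict (\<lambda>j. \<lfloor>real m * t j\<rfloor>) {..<n}"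
  define a where "a j = (if j < n then real_of_int (k j) / real m else 0)" for j
  have "\<lfloor>real m * t j\<rfloor> \<in> {- int m..int m}" for j
  proof -
    have "real m * (- 1) \<le> real m * t j" "real m * t j \<le> real m * 1"
      using assms(3)[of j] by (intro mult_left_mono; simp)+
    then show ?thesis
      using floor_mono[of "real m * t j" "real m"] by (simp add: le_floor_iff)
  qed
  then have "k \<in> PiE {..<n} (\<lambda>_. {- int m..int m})"
    by (auto simp: k_def)
  then show "a \<in> grid n m"
    by (auto simp: a_def[abs_def] grid_def)
  have "\<bar>t j - a j\<bar> \<le> 1 / real m" if "j < n" for j
  proof -
    have "\<bar>real m * t j - of_int (k j)\<bar> \<le> 1"
      using that unfolding k_def by (simp, linarith)
    moreover have "t j - a j = (real m * t j - of_int (k j)) / real m"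
      using that assms(1) by (simp add: a_def field_simps)
    ultimately show ?thesis
      using assms(1) by (simp add: abs_divide divide_right_mono)
  qed
  then have "(\<Sum>j<n. \<bar>t j - a j\<bar>) \<le> (\<Sum>j<n. 1 / real m)"
    by (intro sum_mono) auto
  then show "(\<Sum>j<n. \<bar>t j - a j\<bar>) \<le> real n / real m"
    by simp
qed

text \<open>With \<open>S k\<close> the sum of the first \<open>k\<close> bumps, scaled so that the total is at least the unit
  \<open>u\<close>, the differences of consecutive \<open>min u (S k)\<close> add up to \<open>u\<close>; unlike normalised
  bumps they are piecewise linear.\<close>

lemma partition_of_unity:
  fixes x :: "nat \<Rightarrow> 'a::banach_lattice"
  assumes "0 < \<delta>"
  obtains N and e :: "nat \<Rightarrow> (nat \<Rightarrow> real) \<Rightarrow> real" and a :: "nat \<Rightarrow> nat \<Rightarrow> real"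
  where "\<And>i. \<exists>z. calc_graph n x (e i) z"
    "\<And>i. i < N \<Longrightarrow> a i \<in> Rn n" "\<And>i j. i < N \<Longrightarrow> \<bar>a i j\<bar> \<le> 1"
    "\<And>i t. 0 \<le> e i t" "\<And>t. (\<Sum>i<N. e i t) = unit_fun n t"
    "\<And>i t. i < N \<Longrightarrow> t \<in> Rn n \<Longrightarrow> 0 < e i t \<Longrightarrow>
      (\<Sum>j<n. \<bar>t j - a i j * unit_fun n t\<bar>) \<le> \<delta> * unit_fun n t"
proof -
  \<comment> \<open>The mesh resolves half of \<open>\<delta>\<close>; the other half gives the
    bumps their height.\<close>
  obtain m :: nat where m: "0 < m" "real n / real m \<le> \<delta> / 2"
  proof -
    obtain m where m: "2 * real n / \<delta> < real m"
      using reals_Archimedean2 by blast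
    moreover have "0 \<le> 2 * real n / \<delta>"
      using assms by simp
    ultimately have "0 < m"
      using of_nat_0_less_iff by (metis le_less_trans)
    with m assms that[of m] show thesis
      by (simp add: field_simps)
  qed
  have "finite (grid n m)"
    unfolding grid_def by (intro finite_imageI finite_PiE) auto
  then obtain N and a :: "nat \<Rightarrow> nat \<Rightarrow> real" where G: "grid n m = a ` {i. i < N}"
    using finite_imp_nat_seg_image_inj_on by metis
  have a: "a i \<in> Rn n" "\<bar>a i j\<bar> \<le> 1" if "i < N" for i j
  proof -
    have "a i \<in> grid n m"
      using that G by blast
    then obtain k where k: "k \<in> PiE {..<n} (\<lambda>_. {- int m..int m})"
      and ai: "a i = (\<lambda>j. if j < n then real_of_int (k j) / real m else 0)"
      unfolding grid_def by blast
    then show "a i \<in> Rn n"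
      by (simp add: Rn_iff)
    show "\<bar>a i j\<bar> \<le> 1"
    proof (cases "j < n")
      case True
      then have "k j \<in> {- int m..int m}"
        by (intro PiE_mem[OF k]) simp
      then have "\<bar>real_of_int (k j)\<bar> \<le> real m"
        by (simp, linarith)
      with True m(1) show ?thesis
        by (simp add: ai)
    qed (simp add: ai)
  qed
  define u where "u = unit_fun n"
  \<comment> \<open>The bump around the ray through \<open>a i\<close>: it is positive exactly where
    the l1 distance from \<open>t\<close> to \<open>u t\<close> times \<open>a i\<close> is below
    \<open>\<delta> * u t\<close>. The factor \<open>2 / \<delta>\<close> makes it at least
    \<open>u t\<close> wherever that distance is at most half as large.\<close>
  define b where "b i t = max 0 (2 / \<delta> * (\<delta> * u t -
      (\<Sum>j<n. \<bar>on_Rn n (\<lambda>t. t j) t - a i j * u t\<bar>)))" for i t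
  define e where "e i t = min (u t) (\<Sum>k<Suc i. b k t) - min (u t) (\<Sum>k<i. b k t)" for i t
  have u: "calc_graph n x u (\<Sum>j<n. \<bar>x j\<bar>)"
    unfolding u_def by (rule calc_graph_unit_fun)
  have u0: "0 \<le> u t" for t
    unfolding u_def by (rule unit_fun_nonneg)
  have b0: "0 \<le> b i t" for i t
    by (simp add: b_def)
  have "\<exists>z. calc_graph n x (b i) z" for i
  proof -
    have "calc_graph n x (b i) (sup 0 ((2 / \<delta>) *\<^sub>R (\<delta> *\<^sub>R (\<Sum>j<n. \<bar>x j\<bar>) -
        (\<Sum>j<n. \<bar>x j - a i j *\<^sub>R (\<Sum>j<n. \<bar>x j\<bar>)\<bar>))))"
      unfolding b_def[abs_def]
      by (intro calc_graph.sup calc_graph.zero calc_graph.scale calc_graph_diff u calc_graph_sum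
          calc_graph_abs calc_graph.proj) auto
    then show ?thesis
      by blast
  qed
  then obtain z where z: "\<And>i. calc_graph n x (b i) (z i)"
    by metis
  have S: "calc_graph n x (\<lambda>t. \<Sum>k<i. b k t) (\<Sum>k<i. z k)" for i
    by (intro calc_graph_sum z)
  show thesis
  proof
    fix i
    show "\<exists>w. calc_graph n x (e i) w"
    proof -
      obtain w w' where "calc_graph n x (\<lambda>t. min (u t) (\<Sum>k<Suc i. b k t)) w"
        "calc_graph n x (\<lambda>t. min (u t) (\<Sum>k<i. b k t)) w'"
        using calc_graph_min[OF u S] by blast
      then show ?thesis
        unfolding e_def[abs_def] by (intro exI) (rule calc_graph_diff)
    qed
  next
    show "0 \<le> e i t" for i t
      using b0[of i t] by (simp add: e_def min_le_iff_disj)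
  next
    fix t
    have "unit_fun n t \<le> (\<Sum>k<N. b k t)"
    proof (cases "t \<in> Rn n \<and> 0 < u t")
      case True
      \<comment> \<open>By homogeneity \<open>t\<close> is scaled to the sphere; a grid point near
        \<open>s\<close> provides a bump that alone reaches \<open>u t\<close>.\<close>
      define s where "s j = t j / u t" for j
      have "s \<in> Rn n"
        using True by (simp add: Rn_iff s_def)
      moreover have "\<bar>s j\<bar> \<le> 1" for j
        using True coord_le_unit_fun[of t n j] by (simp add: s_def u_def)
      ultimately obtain c where "c \<in> grid n m" and c: "(\<Sum>j<n. \<bar>s j - c j\<bar>) \<le> real n / real m"
        by (rule Rn_cube_grid[OF m(1)])
      then obtain i where i: "i < N" "c = a i"
        using G by auto
      have "t j - a i j * u t = u t * (s j - a i j)" for j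
        using True by (simp add: s_def field_simps)
      then have "(\<Sum>j<n. \<bar>t j - a i j * u t\<bar>) = u t * (\<Sum>j<n. \<bar>s j - c j\<bar>)"
        using True by (simp add: i abs_mult sum_distrib_left)
      also have "\<dots> \<le> u t * (\<delta> / 2)"
        using order_trans[OF c m(2)] u0 by (rule mult_left_mono)
      finally have "\<delta> / 2 * u t \<le> \<delta> * u t - (\<Sum>j<n. \<bar>on_Rn n (\<lambda>t. t j) t - a i j * u t\<bar>)"
        using True by (simp add: on_Rn_def algebra_simps)
      then have "2 / \<delta> * (\<delta> / 2 * u t) \<le> b i t"
        unfolding b_def using assms by (intro max.coboundedI2 mult_left_mono) auto
      then have "u t \<le> b i t"
        using assms by simp
      also have "\<dots> \<le> (\<Sum>k<N. b k t)"
        using i b0 by (intro member_le_sum) auto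
      finally show ?thesis
        by (simp add: u_def)
    next
      case False
      have "unit_fun n t = 0"
      proof (cases "t \<in> Rn n")
        case True
        with False u0[of t] show ?thesis
          by (auto simp: u_def)
      qed (simp add: unit_fun_def on_Rn_def)
      then show ?thesis
        by (simp add: b0 sum_nonneg)
    qed
    \<comment> \<open>The sum telescopes. Its upper end is \<open>u t\<close>, as the bumps together
      exceed it, and its lower end is 0.\<close>
    moreover have "(\<Sum>i<N. e i t) = min (u t) (\<Sum>k<N. b k t) - min (u t) 0"
      using sum_lessThan_telescope[of "\<lambda>i. min (u t) (\<Sum>k<i. b k t)" N]
      by (simp only: e_def lessThan_0 sum.empty)
    ultimately show "(\<Sum>i<N. e i t) = unit_fun n t"
      using u0[of t] by (simp add: u_def)
  next
    fix i t assume "i < N" and t: "t \<in> Rn n" and pos: "0 < e i t"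
    \<comment> \<open>If the bump vanished, the two truncated partial sums defining
      \<open>e i t\<close> would coincide.\<close>
    have "0 < b i t"
    proof (rule ccontr)
      assume "\<not> ?thesis"
      with b0[of i t] have "b i t = 0"
        by simp
      with pos show False
        by (simp add: e_def)
    qed
    then have "0 < 2 / \<delta> * (\<delta> * u t - (\<Sum>j<n. \<bar>on_Rn n (\<lambda>t. t j) t - a i j * u t\<bar>))"
      unfolding b_def by (simp only: less_max_iff_disj less_irrefl simp_thms)
    then have "0 < \<delta> * u t - (\<Sum>j<n. \<bar>on_Rn n (\<lambda>t. t j) t - a i j * u t\<bar>)"
      by (rule zero_less_mult_pos) (use assms in simp)
    then show "(\<Sum>j<n. \<bar>t j - a i j * unit_fun n t\<bar>) \<le> \<delta> * unit_fun n t"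
      using t by (simp add: u_def on_Rn_def)
  qed (use a in auto)
qed

section \<open>Extension to continuous homogeneous functions\<close>

text \<open>The topology of \<open>Euclidean_space n\<close> is the one induced by the product
  topology, so continuity can be treated as \<open>continuous_on\<close>.\<close>

lemma hom_fun_iff:
  "h \<in> hom_fun n \<longleftrightarrow> continuous_on (Rn n) h \<and>
    (\<forall>t\<in>Rn n. \<forall>c\<ge>0. h (\<lambda>i. c * t i) = c * h t) \<and> (\<forall>t. t \<notin> Rn n \<longrightarrow> h t = 0)"
proof -
  have "Euclidean_space n = subtopology euclidean (Rn n)"
    unfolding topspace_Euclidean_space by (simp add: Euclidean_space_def euclidean_product_topology)
  then have "continuous_map (Euclidean_space n) euclideanreal h \<longleftrightarrow> continuous_on (Rn n) h"
    by (metis continuous_map_iff_continuous)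
  then show ?thesis
    by (simp add: hom_fun_def)
qed

lemma hom_fun_zero: "(\<lambda>_. 0) \<in> hom_fun n"
  by (simp add: hom_fun_iff)

lemma hom_fun_add: "h \<in> hom_fun n \<Longrightarrow> k \<in> hom_fun n \<Longrightarrow> (\<lambda>t. h t + k t) \<in> hom_fun n"
  by (auto simp: hom_fun_iff algebra_simps intro: continuous_intros)

lemma hom_fun_scale: "h \<in> hom_fun n \<Longrightarrow> (\<lambda>t. c * h t) \<in> hom_fun n"
  by (auto simp: hom_fun_iff algebra_simps intro: continuous_intros)

lemma hom_fun_max: "h \<in> hom_fun n \<Longrightarrow> k \<in> hom_fun n \<Longrightarrow> (\<lambda>t. max (h t) (k t)) \<in> hom_fun n"
  by (auto simp: hom_fun_iff max_mult_distrib_left intro: continuous_intros)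

lemma hom_fun_sum:
  "(\<And>i. i \<in> I \<Longrightarrow> h i \<in> hom_fun n) \<Longrightarrow> (\<lambda>t. \<Sum>i\<in>I. h i t) \<in> hom_fun n"
  by (induction I rule: infinite_finite_induct) (simp_all add: hom_fun_zero hom_fun_add)

lemma hom_fun_proj: "on_Rn n (\<lambda>t. t j) \<in> hom_fun n"
proof -
  have "continuous_on (Rn n) (\<lambda>t. t j)"
    by (rule continuous_on_subset[OF continuous_on_product_coordinates]) simp
  then have "continuous_on (Rn n) (on_Rn n (\<lambda>t. t j))"
    by (simp add: on_Rn_def cong: continuous_on_cong)
  then show ?thesis
    by (auto simp: hom_fun_iff on_Rn_def Rn_iff)
qed

lemma calc_graph_hom_fun: "calc_graph n x h y \<Longrightarrow> h \<in> hom_fun n"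
  by (induction rule: calc_graph.induct)
    (simp_all add: hom_fun_zero hom_fun_proj hom_fun_add hom_fun_scale hom_fun_max)

text \<open>The metric on sequences weights the truncated coordinate distances by powers of 1/2,
  whose sum is 2.\<close>

lemma dist_fun_le:
  fixes s t :: "nat \<Rightarrow> real"
  assumes "\<And>j. \<bar>s j - t j\<bar> \<le> d"
  shows "dist s t \<le> 2 * d"
proof -
  have "summable (\<lambda>i. (1/2)^i * d)"
    by (intro summable_mult2) simp
  moreover have "summable (\<lambda>i. (1/2)^i * min (dist (s (from_nat i)) (t (from_nat i))) 1)"
    by (rule summable_comparison_test'[of "\<lambda>n. (1/2)^n"]) (auto simp: summable_geometric_iff)
  moreover have "min (dist (s i) (t i)) 1 \<le> d" for i
    using assms[of i] by (simp add: dist_real_def)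
  ultimately have "dist s t \<le> (\<Sum>i. (1/2)^i * d)"
    unfolding dist_fun_def by (intro suminf_le) (auto intro!: mult_left_mono)
  also have "\<dots> = 2 * d"
    using suminf_mult2[of "\<lambda>i. (1/2)^i :: real" d] suminf_geometric[of "1/2::real"] by simp
  finally show ?thesis .
qed

lemma hom_fun_modulus:
  assumes h: "h \<in> hom_fun n" and "0 < \<epsilon>"
  obtains \<delta> where "0 < \<delta>"
    "\<And>s t. s \<in> Rn n \<Longrightarrow> t \<in> Rn n \<Longrightarrow> (\<And>j. \<bar>s j\<bar> \<le> 1) \<Longrightarrow> (\<And>j. \<bar>t j\<bar> \<le> 1) \<Longrightarrow>
      (\<Sum>j<n. \<bar>s j - t j\<bar>) \<le> \<delta> \<Longrightarrow> \<bar>h s - h t\<bar> \<le> \<epsilon>"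
proof -
  \<comment> \<open>The cube inside \<open>Rn n\<close>, written as a product over all indices so
    that its compactness comes from Tychonoff's theorem; uniform continuity on it gives the
    modulus.\<close>
  define C where "C = PiE UNIV (\<lambda>j. if j < n then {-1..1::real} else {0})"
  have "compact C"
    using compactin_PiE[of "\<lambda>_. euclideanreal" UNIV "\<lambda>j. if j < n then {-1..1} else {0}"]
    by (auto simp: C_def euclidean_product_topology)
  moreover have "C \<subseteq> Rn n"
    by (auto simp: C_def Rn_iff PiE_iff leD split: if_splits) (metis leD singletonD)
  ultimately have "uniformly_continuous_on C h"
    using h by (intro compact_uniformly_continuous) (auto simp: hom_fun_iff intro: continuous_on_subset)
  with \<open>0 < \<epsilon>\<close> obtain d where d: "0 < d"
    "\<And>s t. s \<in> C \<Longrightarrow> t \<in> C \<Longrightarrow> dist t s < d \<Longrightarrow> dist (h t) (h s) < \<epsilon>"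
    unfolding uniformly_continuous_on_def by metis
  show thesis
  proof
    \<comment> \<open>The product metric may double a coordinatewise bound, and
      \<open>2 * (d / 4)\<close> is still strictly below \<open>d\<close>.\<close>
    show "0 < d / 4"
      using d(1) by simp
    fix s t :: "nat \<Rightarrow> real"
    assume st: "s \<in> Rn n" "t \<in> Rn n" "\<And>j. \<bar>s j\<bar> \<le> 1" "\<And>j. \<bar>t j\<bar> \<le> 1"
      and le: "(\<Sum>j<n. \<bar>s j - t j\<bar>) \<le> d / 4"
    have "s \<in> C" "t \<in> C"
      using st by (auto simp: C_def PiE_iff Rn_iff abs_le_iff minus_le_iff)
    have "(\<lambda>j. s j - t j) \<in> Rn n"
      using st by (simp add: Rn_iff)
    then have "\<bar>s j - t j\<bar> \<le> d / 4" for j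
      using le coord_le_unit_fun[of "\<lambda>j. s j - t j" n j] by (simp add: unit_fun_Rn)
    then have "dist s t \<le> 2 * (d / 4)"
      by (rule dist_fun_le)
    then have "dist (h s) (h t) < \<epsilon>"
      using d \<open>s \<in> C\<close> \<open>t \<in> C\<close> by auto
    then show "\<bar>h s - h t\<bar> \<le> \<epsilon>"
      by (simp add: dist_real_def)
  qed
qed

text \<open>Where \<open>e i t\<close> is positive, \<open>t\<close> divided by its l1 norm is close
  to \<open>a i\<close>, so \<open>h\<close> differs little at these two points. Homogeneity and
  summation against the weights \<open>e i t\<close> give the estimate. A finite set
  \<open>H\<close> is treated at once so that the same nodes serve several functions.\<close>

lemma hom_fun_approx:
  fixes x :: "nat \<Rightarrow> 'a::banach_lattice"
  assumes "finite H" "H \<subseteq> hom_fun n" "0 < \<epsilon>"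
  obtains N and e :: "nat \<Rightarrow> (nat \<Rightarrow> real) \<Rightarrow> real" and a :: "nat \<Rightarrow> nat \<Rightarrow> real"
  where "\<And>i. \<exists>z. calc_graph n x (e i) z"
    "\<And>i. i < N \<Longrightarrow> a i \<in> Rn n" "\<And>i t. 0 \<le> e i t"
    "\<And>h t. h \<in> H \<Longrightarrow> t \<in> Rn n \<Longrightarrow> \<bar>h t - (\<Sum>i<N. h (a i) * e i t)\<bar> \<le> \<epsilon> * unit_fun n t"
proof -
  have "\<forall>h\<in>H. \<exists>\<delta>>0. \<forall>s t. s \<in> Rn n \<longrightarrow> t \<in> Rn n \<longrightarrow> (\<forall>j. \<bar>s j\<bar> \<le> 1) \<longrightarrow> (\<forall>j. \<bar>t j\<bar> \<le> 1) \<longrightarrow>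
      (\<Sum>j<n. \<bar>s j - t j\<bar>) \<le> \<delta> \<longrightarrow> \<bar>h s - h t\<bar> \<le> \<epsilon>"
  proof
    fix h assume "h \<in> H"
    then have "h \<in> hom_fun n"
      using assms(2) by blast
    then obtain \<delta> where "0 < \<delta>"
      "\<And>s t. s \<in> Rn n \<Longrightarrow> t \<in> Rn n \<Longrightarrow> (\<And>j. \<bar>s j\<bar> \<le> 1) \<Longrightarrow> (\<And>j. \<bar>t j\<bar> \<le> 1) \<Longrightarrow>
        (\<Sum>j<n. \<bar>s j - t j\<bar>) \<le> \<delta> \<Longrightarrow> \<bar>h s - h t\<bar> \<le> \<epsilon>"
      using hom_fun_modulus[OF _ \<open>0 < \<epsilon>\<close>] by blast
    then show "\<exists>\<delta>>0. \<forall>s t. s \<in> Rn n \<longrightarrow> t \<in> Rn n \<longrightarrow> (\<forall>j. \<bar>s j\<bar> \<le> 1) \<longrightarrow> (\<forall>j. \<bar>t j\<bar> \<le> 1) \<longrightarrow>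
      (\<Sum>j<n. \<bar>s j - t j\<bar>) \<le> \<delta> \<longrightarrow> \<bar>h s - h t\<bar> \<le> \<epsilon>"
      by (intro exI[of _ \<delta>]) simp
  qed
  from bchoice[OF this] obtain d where "\<forall>h\<in>H. 0 < d h \<and> (\<forall>s t. s \<in> Rn n \<longrightarrow> t \<in> Rn n \<longrightarrow>
      (\<forall>j. \<bar>s j\<bar> \<le> 1) \<longrightarrow> (\<forall>j. \<bar>t j\<bar> \<le> 1) \<longrightarrow> (\<Sum>j<n. \<bar>s j - t j\<bar>) \<le> d h \<longrightarrow> \<bar>h s - h t\<bar> \<le> \<epsilon>)" ..
  then have d: "\<And>h. h \<in> H \<Longrightarrow> 0 < d h"
    "\<And>h s t. h \<in> H \<Longrightarrow> s \<in> Rn n \<Longrightarrow> t \<in> Rn n \<Longrightarrow> (\<And>j. \<bar>s j\<bar> \<le> 1) \<Longrightarrow> (\<And>j. \<bar>t j\<bar> \<le> 1) \<Longrightarrow>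
      (\<Sum>j<n. \<bar>s j - t j\<bar>) \<le> d h \<Longrightarrow> \<bar>h s - h t\<bar> \<le> \<epsilon>"
    by simp_all
  \<comment> \<open>The element 1 keeps the minimum meaningful when \<open>H\<close> is
    empty.\<close>
  define \<delta> where "\<delta> = Min (insert 1 (d ` H))"
  have "0 < \<delta>" and \<delta>: "\<And>h. h \<in> H \<Longrightarrow> \<delta> \<le> d h"
    using assms(1) d(1) by (auto simp: \<delta>_def)
  show thesis
  proof (rule partition_of_unity[OF \<open>0 < \<delta>\<close>, of n x])
    fix N and e :: "nat \<Rightarrow> (nat \<Rightarrow> real) \<Rightarrow> real" and a :: "nat \<Rightarrow> nat \<Rightarrow> real"
    assume e: "\<And>i. \<exists>z. calc_graph n x (e i) z"
      and a: "\<And>i. i < N \<Longrightarrow> a i \<in> Rn n" "\<And>i j. i < N \<Longrightarrow> \<bar>a i j\<bar> \<le> 1"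
      and e0: "\<And>i t. 0 \<le> e i t" and sum_e: "\<And>t. (\<Sum>i<N. e i t) = unit_fun n t"
      and supp: "\<And>i t. i < N \<Longrightarrow> t \<in> Rn n \<Longrightarrow> 0 < e i t \<Longrightarrow>
        (\<Sum>j<n. \<bar>t j - a i j * unit_fun n t\<bar>) \<le> \<delta> * unit_fun n t"
    have "\<bar>h t - (\<Sum>i<N. h (a i) * e i t)\<bar> \<le> \<epsilon> * unit_fun n t"
      if h: "h \<in> H" and t: "t \<in> Rn n" for h t
    proof (cases "unit_fun n t = 0")
      case True
      then have "t j = 0" for j
        using coord_le_unit_fun[OF t, of j] by simp
      then have t0: "(\<lambda>i. 0 * t i) = t"
        by auto
      \<comment> \<open>Here \<open>t\<close> is the origin, and homogeneity with factor 0 forces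
        \<open>h t = 0\<close>.\<close>
      have "h (\<lambda>i. 0 * t i) = 0 * h t"
        using h t assms(2) unfolding hom_fun_iff subset_iff by blast
      then have "h t = 0 * h t"
        unfolding t0 .
      moreover have "e i t = 0" if "i < N" for i
        using True sum_e[of t] e0 that by (simp add: sum_nonneg_eq_0_iff)
      ultimately show ?thesis
        using True by simp
    next
      case False
      define r where "r = unit_fun n t"
      have r: "0 < r"
        using False unit_fun_nonneg[of n t] by (simp add: r_def)
      define s where "s j = inverse r * t j" for j
      have s: "s \<in> Rn n"
        using t by (simp add: s_def Rn_iff)
      have s1: "\<bar>s j\<bar> \<le> 1" for j
        using r coord_le_unit_fun[OF t, of j] by (simp add: s_def r_def abs_mult field_simps)
      have "h s = inverse r * h t"
        unfolding s_def[abs_def] using h t assms(2) r by (auto simp: hom_fun_iff subset_iff)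
      then have ht: "h t = h s * r"
        using r by simp
      \<comment> \<open>With the factor \<open>e i t\<close> the estimate holds for every node,
        being trivial off the support of \<open>e i\<close>.\<close>
      have near: "\<bar>h s - h (a i)\<bar> * e i t \<le> \<epsilon> * e i t" if i: "i < N" for i
      proof (cases "e i t = 0")
        case False
        then have "(\<Sum>j<n. \<bar>t j - a i j * r\<bar>) \<le> \<delta> * r"
          using supp[OF i t] e0[of i t] by (simp add: r_def)
        moreover have "\<bar>t j - a i j * r\<bar> = \<bar>s j - a i j\<bar> * r" for j
        proof -
          have "t j - a i j * r = (s j - a i j) * r"
            using r by (simp add: s_def field_simps)
          then show ?thesis
            using r by (simp add: abs_mult)
        qed
        ultimately have "(\<Sum>j<n. \<bar>s j - a i j\<bar>) * r \<le> \<delta> * r"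
          by (simp add: sum_distrib_right)
        then have "(\<Sum>j<n. \<bar>s j - a i j\<bar>) \<le> d h"
          using r \<delta>[OF h] by simp
        then have "\<bar>h s - h (a i)\<bar> \<le> \<epsilon>"
          using d(2)[OF h s a(1)[OF i] s1 a(2)[OF i]] by simp
        then show ?thesis
          using e0 by (rule mult_right_mono)
      qed simp
      have "h t - (\<Sum>i<N. h (a i) * e i t) = (\<Sum>i<N. (h s - h (a i)) * e i t)"
        using sum_e[of t] by (simp add: ht r_def left_diff_distrib sum_subtractf flip: sum_distrib_left)
      also have "\<bar>\<dots>\<bar> \<le> (\<Sum>i<N. \<bar>h s - h (a i)\<bar> * e i t)"
        by (rule order_trans[OF sum_abs]) (simp add: abs_mult e0)
      also have "\<dots> \<le> (\<Sum>i<N. \<epsilon> * e i t)"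
        by (intro sum_mono near) simp
      also have "\<dots> = \<epsilon> * unit_fun n t"
        by (simp add: sum_e flip: sum_distrib_left)
      finally show ?thesis .
    qed
    with e a(1) e0 show thesis
      by (rule that)
  qed
qed

text \<open>The closure of the graph with respect to the order-unit norm on functions and the norm
  of the lattice. It is total on \<open>hom_fun n\<close> by completeness and single-valued by
  continuity, hence the graph of the extended calculus.\<close>

definition calc_closure ::
    "nat \<Rightarrow> (nat \<Rightarrow> 'a::banach_lattice) \<Rightarrow> ((nat \<Rightarrow> real) \<Rightarrow> real) \<Rightarrow> 'a \<Rightarrow> bool"
  where "calc_closure n x h y \<longleftrightarrow> (\<forall>\<epsilon>>0. \<exists>g z. calc_graph n x g z \<and>
    (\<forall>t\<in>Rn n. \<bar>h t - g t\<bar> \<le> \<epsilon> * unit_fun n t) \<and> norm (y - z) \<le> \<epsilon>)"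

lemma calc_closureE:
  assumes "calc_closure n x h y" "0 < \<epsilon>"
  obtains g z where "calc_graph n x g z" "\<And>t. t \<in> Rn n \<Longrightarrow> \<bar>h t - g t\<bar> \<le> \<epsilon> * unit_fun n t"
    "norm (y - z) \<le> \<epsilon>"
  using assms unfolding calc_closure_def by meson

lemma calc_closure_graph: "calc_graph n x h y \<Longrightarrow> calc_closure n x h y"
  unfolding calc_closure_def
  by (intro allI impI exI[of _ h] exI[of _ y]) (auto simp: unit_fun_nonneg)

lemma calc_closure_add:
  assumes "calc_closure n x h y" "calc_closure n x k z"
  shows "calc_closure n x (\<lambda>t. h t + k t) (y + z)"
  unfolding calc_closure_def
proof (intro allI impI)
  fix \<epsilon> :: real assume "0 < \<epsilon>"
  then have "0 < \<epsilon> / 2"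
    by simp
  obtain g v where g: "calc_graph n x g v"
    "\<And>t. t \<in> Rn n \<Longrightarrow> \<bar>h t - g t\<bar> \<le> \<epsilon> / 2 * unit_fun n t" "norm (y - v) \<le> \<epsilon> / 2"
    using calc_closureE[OF assms(1) \<open>0 < \<epsilon> / 2\<close>] by blast
  obtain f w where f: "calc_graph n x f w"
    "\<And>t. t \<in> Rn n \<Longrightarrow> \<bar>k t - f t\<bar> \<le> \<epsilon> / 2 * unit_fun n t" "norm (z - w) \<le> \<epsilon> / 2"
    using calc_closureE[OF assms(2) \<open>0 < \<epsilon> / 2\<close>] by blast
  have "\<bar>(h t + k t) - (g t + f t)\<bar> \<le> \<epsilon> * unit_fun n t" if "t \<in> Rn n" for t
    using g(2)[OF that] f(2)[OF that] by linarith
  moreover have "norm ((y + z) - (v + w)) \<le> \<epsilon>"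
    using norm_diff_triangle_ineq[of y z v w] g(3) f(3) by linarith
  ultimately show "\<exists>g' z'. calc_graph n x g' z' \<and>
      (\<forall>t\<in>Rn n. \<bar>(h t + k t) - g' t\<bar> \<le> \<epsilon> * unit_fun n t) \<and> norm ((y + z) - z') \<le> \<epsilon>"
    using calc_graph.add[OF g(1) f(1)] by blast
qed

lemma calc_closure_scale:
  assumes "calc_closure n x h y"
  shows "calc_closure n x (\<lambda>t. c * h t) (c *\<^sub>R y)"
  unfolding calc_closure_def
proof (intro allI impI)
  fix \<epsilon> :: real assume "0 < \<epsilon>"
  define \<eta> where "\<eta> = \<epsilon> / (\<bar>c\<bar> + 1)"
  have \<eta>: "0 < \<eta>" "\<bar>c\<bar> * \<eta> \<le> \<epsilon>"
    using \<open>0 < \<epsilon>\<close> by (auto simp: \<eta>_def field_simps)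
  obtain g v where g: "calc_graph n x g v"
    "\<And>t. t \<in> Rn n \<Longrightarrow> \<bar>h t - g t\<bar> \<le> \<eta> * unit_fun n t" "norm (y - v) \<le> \<eta>"
    using calc_closureE[OF assms \<eta>(1)] by blast
  have "\<bar>c * h t - c * g t\<bar> \<le> \<epsilon> * unit_fun n t" if "t \<in> Rn n" for t
  proof -
    have "\<bar>c * h t - c * g t\<bar> = \<bar>c\<bar> * \<bar>h t - g t\<bar>"
      by (simp flip: abs_mult right_diff_distrib)
    also have "\<dots> \<le> \<bar>c\<bar> * (\<eta> * unit_fun n t)"
      using g(2)[OF that] by (intro mult_left_mono) auto
    also have "\<dots> \<le> \<epsilon> * unit_fun n t"
      using mult_right_mono[OF \<eta>(2) unit_fun_nonneg] by (simp add: mult.assoc)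
    finally show ?thesis .
  qed
  moreover have "norm (c *\<^sub>R y - c *\<^sub>R v) \<le> \<epsilon>"
    using mult_left_mono[OF g(3), of "\<bar>c\<bar>"] \<eta>(2) by (simp flip: scaleR_right_diff_distrib)
  ultimately show "\<exists>g' z'. calc_graph n x g' z' \<and>
      (\<forall>t\<in>Rn n. \<bar>c * h t - g' t\<bar> \<le> \<epsilon> * unit_fun n t) \<and> norm (c *\<^sub>R y - z') \<le> \<epsilon>"
    using calc_graph.scale[OF g(1)] by blast
qed

text \<open>Raising \<open>c\<close> and \<open>d\<close> by \<open>r\<close> dominates
  \<open>a\<close> and \<open>b\<close>, and conversely, so the suprema differ by at most
  \<open>r\<close> in the order. This carries the lattice operation through limits.\<close>

lemma norm_sup_diff_le:
  fixes a b c d :: "'a::banach_lattice"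
  shows "norm (sup a b - sup c d) \<le> norm (a - c) + norm (b - d)"
proof -
  define r where "r = \<bar>a - c\<bar> + \<bar>b - d\<bar>"
  have r: "0 \<le> r"
    by (simp add: r_def)
  have le: "\<bar>a - c\<bar> \<le> r" "\<bar>b - d\<bar> \<le> r"
    by (simp_all add: r_def)
  then have "a \<le> c + r" "c \<le> a + r" "b \<le> d + r" "d \<le> b + r"
    by (auto simp: abs_le_iff diff_le_eq add.commute)
  then have "sup a b \<le> sup c d + r" "sup c d \<le> sup a b + r"
    by (meson add_right_mono le_supI order_trans sup_ge1 sup_ge2)+
  then have "\<bar>sup a b - sup c d\<bar> \<le> r"
    by (simp only: abs_le_iff minus_diff_eq diff_le_eq add.commute)
  then have "\<bar>sup a b - sup c d\<bar> \<le> \<bar>r\<bar>"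
    using r by simp
  then have "norm (sup a b - sup c d) \<le> norm r"
    by (rule norm_mono_abs)
  also have "\<dots> \<le> norm (a - c) + norm (b - d)"
    unfolding r_def by (rule order_trans[OF norm_triangle_ineq]) simp
  finally show ?thesis .
qed

lemma calc_closure_sup:
  assumes "calc_closure n x h y" "calc_closure n x k z"
  shows "calc_closure n x (\<lambda>t. max (h t) (k t)) (sup y z)"
  unfolding calc_closure_def
proof (intro allI impI)
  fix \<epsilon> :: real assume "0 < \<epsilon>"
  then have "0 < \<epsilon> / 2"
    by simp
  obtain g v where g: "calc_graph n x g v"
    "\<And>t. t \<in> Rn n \<Longrightarrow> \<bar>h t - g t\<bar> \<le> \<epsilon> / 2 * unit_fun n t" "norm (y - v) \<le> \<epsilon> / 2"
    using calc_closureE[OF assms(1) \<open>0 < \<epsilon> / 2\<close>] by blast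
  obtain f w where f: "calc_graph n x f w"
    "\<And>t. t \<in> Rn n \<Longrightarrow> \<bar>k t - f t\<bar> \<le> \<epsilon> / 2 * unit_fun n t" "norm (z - w) \<le> \<epsilon> / 2"
    using calc_closureE[OF assms(2) \<open>0 < \<epsilon> / 2\<close>] by blast
  have "\<bar>max (h t) (k t) - max (g t) (f t)\<bar> \<le> \<epsilon> * unit_fun n t" if "t \<in> Rn n" for t
    using g(2)[OF that] f(2)[OF that] by linarith
  moreover have "norm (sup y z - sup v w) \<le> \<epsilon>"
    using norm_sup_diff_le[of y z v w] g(3) f(3) by linarith
  ultimately show "\<exists>g' z'. calc_graph n x g' z' \<and>
      (\<forall>t\<in>Rn n. \<bar>max (h t) (k t) - g' t\<bar> \<le> \<epsilon> * unit_fun n t) \<and> norm (sup y z - z') \<le> \<epsilon>"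
    using calc_graph.sup[OF g(1) f(1)] by blast
qed

lemma calc_closure_unique:
  assumes "calc_closure n x h y" "calc_closure n x h z"
  shows "y = z"
proof -
  define U where "U = (\<Sum>j<n. \<bar>x j\<bar>)"
  have "norm (y - z) \<le> 0 + \<epsilon>" if "0 < \<epsilon>" for \<epsilon>
  proof -
    \<comment> \<open>The path from \<open>y\<close> to \<open>z\<close> through the approximants
      \<open>v\<close> and \<open>w\<close> costs \<open>\<eta>\<close> at either end and
      \<open>2 * \<eta> * norm U\<close> in the middle.\<close>
    define \<eta> where "\<eta> = \<epsilon> / (2 * norm U + 2)"
    have \<eta>: "0 < \<eta>" "2 * \<eta> * norm U + 2 * \<eta> = \<epsilon>"
    proof -
      have "0 < 2 * norm U + 2"
        using norm_ge_zero[of U] by linarith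
      with that have "0 < \<eta>" "\<eta> * (2 * norm U + 2) = \<epsilon>"
        by (simp_all add: \<eta>_def)
      then show "0 < \<eta>" "2 * \<eta> * norm U + 2 * \<eta> = \<epsilon>"
        by (simp_all add: algebra_simps)
    qed
    obtain g v where g: "calc_graph n x g v"
      "\<And>t. t \<in> Rn n \<Longrightarrow> \<bar>h t - g t\<bar> \<le> \<eta> * unit_fun n t" "norm (y - v) \<le> \<eta>"
      using calc_closureE[OF assms(1) \<eta>(1)] by blast
    obtain f w where f: "calc_graph n x f w"
      "\<And>t. t \<in> Rn n \<Longrightarrow> \<bar>h t - f t\<bar> \<le> \<eta> * unit_fun n t" "norm (z - w) \<le> \<eta>"
      using calc_closureE[OF assms(2) \<eta>(1)] by blast
    have "\<bar>g t - f t\<bar> \<le> (2 * \<eta>) * unit_fun n t" if "t \<in> Rn n" for t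
      using g(2)[OF that] f(2)[OF that] by linarith
    then have "norm (v - w) \<le> (2 * \<eta>) * norm U"
      unfolding U_def using g(1) f(1) \<eta>(1) by (intro calc_graph_norm_le) auto
    moreover have "norm (y - z) \<le> norm (y - v) + norm (v - w) + norm (z - w)"
      using norm_triangle_ineq[of "y - v" "v - z"] norm_triangle_ineq[of "v - w" "w - z"]
      by (simp add: norm_minus_commute)
    ultimately show ?thesis
      using g(3) f(3) \<eta>(2) by linarith
  qed
  then have "norm (y - z) \<le> 0"
    by (rule field_le_epsilon)
  then show ?thesis
    by simp
qed

text \<open>Piecewise linear approximants with errors \<open>1 / (m + 1)\<close> have Cauchy values
  by \<open>calc_graph_norm_le\<close>; their limit is the required element.\<close>

lemma calc_closure_exists:
  fixes x :: "nat \<Rightarrow> 'a::banach_lattice"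
  assumes "h \<in> hom_fun n"
  obtains y where "calc_closure n x h y"
proof -
  define U where "U = (\<Sum>j<n. \<bar>x j\<bar>)"
  have "\<exists>g z. calc_graph n x g z \<and> (\<forall>t\<in>Rn n. \<bar>h t - g t\<bar> \<le> \<epsilon> * unit_fun n t)"
    if "0 < \<epsilon>" for \<epsilon>
  proof -
    have "finite {h}" "{h} \<subseteq> hom_fun n"
      using assms by auto
    then obtain N and e :: "nat \<Rightarrow> (nat \<Rightarrow> real) \<Rightarrow> real" and a :: "nat \<Rightarrow> nat \<Rightarrow> real"
      where e: "\<And>i. \<exists>z. calc_graph n x (e i) z"
        and "\<And>i. i < N \<Longrightarrow> a i \<in> Rn n" "\<And>i t. 0 \<le> e i t"
        and le: "\<And>k t. k \<in> {h} \<Longrightarrow> t \<in> Rn n \<Longrightarrow>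
          \<bar>k t - (\<Sum>i<N. k (a i) * e i t)\<bar> \<le> \<epsilon> * unit_fun n t"
      using \<open>0 < \<epsilon>\<close> by (rule hom_fun_approx) (rule that, assumption+)
    obtain z where "\<And>i. calc_graph n x (e i) (z i)"
      using e by metis
    then have "calc_graph n x (\<lambda>t. \<Sum>i<N. h (a i) * e i t) (\<Sum>i<N. h (a i) *\<^sub>R z i)"
      by (intro calc_graph_sum calc_graph.scale)
    with le show ?thesis
      by blast
  qed
  then have "\<forall>m. \<exists>g z. calc_graph n x g z \<and>
      (\<forall>t\<in>Rn n. \<bar>h t - g t\<bar> \<le> inverse (real (Suc m)) * unit_fun n t)"
    by simp
  then obtain g z where "\<forall>m. calc_graph n x (g m) (z m) \<and>
      (\<forall>t\<in>Rn n. \<bar>h t - g m t\<bar> \<le> inverse (real (Suc m)) * unit_fun n t)"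
    by metis
  then have g: "calc_graph n x (g m) (z m)"
    and le: "t \<in> Rn n \<Longrightarrow> \<bar>h t - g m t\<bar> \<le> inverse (real (Suc m)) * unit_fun n t" for m t
    by blast+
  have z: "norm (z k - z m) \<le> (2 * inverse (real (Suc M))) * norm U" if "M \<le> k" "M \<le> m" for k m M
    unfolding U_def
  proof (rule calc_graph_norm_le[OF g g])
    fix t assume t: "t \<in> Rn n"
    have "\<bar>h t - g i t\<bar> \<le> inverse (real (Suc M)) * unit_fun n t" if "M \<le> i" for i
      by (rule order_trans[OF le[OF t]], rule mult_right_mono)
        (use that in \<open>auto simp: unit_fun_nonneg field_simps\<close>)
    from this[OF that(1)] this[OF that(2)]
    show "\<bar>g k t - g m t\<bar> \<le> 2 * inverse (real (Suc M)) * unit_fun n t"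
      by linarith
  qed simp
  have lim0: "(\<lambda>M. (2 * inverse (real (Suc M))) * norm U) \<longlonglongrightarrow> 0"
    using tendsto_mult_left_zero[OF tendsto_mult_right_zero[OF LIMSEQ_inverse_real_of_nat, of 2]] .
  have "Cauchy z"
  proof (rule CauchyI)
    fix \<epsilon> :: real assume "0 < \<epsilon>"
    then have "eventually (\<lambda>M. (2 * inverse (real (Suc M))) * norm U < \<epsilon>) sequentially"
      by (rule order_tendstoD(2)[OF lim0])
    then obtain M where M: "(2 * inverse (real (Suc M))) * norm U < \<epsilon>"
      using eventually_happens'[OF sequentially_bot] by blast
    show "\<exists>M. \<forall>k\<ge>M. \<forall>m\<ge>M. norm (z k - z m) < \<epsilon>"
      by (intro exI[of _ M] allI impI le_less_trans[OF z M])
  qed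
  then obtain y where y: "z \<longlonglongrightarrow> y"
    using Cauchy_convergent_iff convergent_def by blast
  have "calc_closure n x h y"
    unfolding calc_closure_def
  proof (intro allI impI)
    fix \<epsilon> :: real assume "0 < \<epsilon>"
    then have "eventually (\<lambda>m. norm (z m - y) < \<epsilon>) sequentially"
      using tendstoD[OF y] by (simp add: dist_norm)
    moreover have "eventually (\<lambda>m. inverse (real (Suc m)) < \<epsilon>) sequentially"
      using order_tendstoD(2)[OF LIMSEQ_inverse_real_of_nat \<open>0 < \<epsilon>\<close>] .
    ultimately obtain m where m: "norm (z m - y) < \<epsilon>" "inverse (real (Suc m)) < \<epsilon>"
      using eventually_happens'[OF sequentially_bot eventually_conj] by blast
    have "\<bar>h t - g m t\<bar> \<le> \<epsilon> * unit_fun n t" if "t \<in> Rn n" for t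
      by (rule order_trans[OF le[OF that]], rule mult_right_mono) (use m unit_fun_nonneg in auto)
    moreover have "norm (y - z m) \<le> \<epsilon>"
      using m(1) by (simp add: norm_minus_commute)
    ultimately show "\<exists>g z. calc_graph n x g z \<and>
        (\<forall>t\<in>Rn n. \<bar>h t - g t\<bar> \<le> \<epsilon> * unit_fun n t) \<and> norm (y - z) \<le> \<epsilon>"
      using g by blast
  qed
  then show thesis
    by (rule that)
qed

section \<open>Positivity, continuity and uniqueness of an arbitrary Krivine calculus\<close>

context
  fixes n :: nat and x :: "nat \<Rightarrow> 'a::banach_lattice" and \<tau>
  assumes \<tau>: "is_krivine_calculus n x \<tau>"
begin

lemma krivine_add: "h \<in> hom_fun n \<Longrightarrow> k \<in> hom_fun n \<Longrightarrow> \<tau> (\<lambda>t. h t + k t) = \<tau> h + \<tau> k"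
  and krivine_scale: "h \<in> hom_fun n \<Longrightarrow> \<tau> (\<lambda>t. c * h t) = c *\<^sub>R \<tau> h"
  and krivine_proj: "j < n \<Longrightarrow> \<tau> (on_Rn n (\<lambda>t. t j)) = x j"
  and krivine_max: "h \<in> hom_fun n \<Longrightarrow> k \<in> hom_fun n \<Longrightarrow> \<tau> (\<lambda>t. max (h t) (k t)) = sup (\<tau> h) (\<tau> k)"
  using \<tau> unfolding is_krivine_calculus_def by blast+

lemma krivine_zero: "\<tau> (\<lambda>_. 0) = 0"
  using krivine_scale[OF hom_fun_zero, of 0] by simp

lemma krivine_sum:
  "(\<And>i. i \<in> I \<Longrightarrow> h i \<in> hom_fun n) \<Longrightarrow> \<tau> (\<lambda>t. \<Sum>i\<in>I. h i t) = (\<Sum>i\<in>I. \<tau> (h i))"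
  by (induction I rule: infinite_finite_induct)
    (simp_all add: krivine_zero krivine_add hom_fun_sum)

text \<open>The inequality means that the maximum of \<open>h\<close> and \<open>k\<close> is
  \<open>k\<close>. As both vanish off \<open>Rn n\<close>, this is an equality of functions, to
  which preservation of maxima applies.\<close>

lemma krivine_mono:
  assumes "h \<in> hom_fun n" "k \<in> hom_fun n" "\<And>t. t \<in> Rn n \<Longrightarrow> h t \<le> k t"
  shows "\<tau> h \<le> \<tau> k"
proof -
  have "(\<lambda>t. max (h t) (k t)) = k"
  proof
    fix t
    show "max (h t) (k t) = k t"
      using assms by (cases "t \<in> Rn n") (simp_all add: hom_fun_iff max_absorb2)
  qed
  then have "\<tau> k = sup (\<tau> h) (\<tau> k)"
    using krivine_max[OF assms(1,2)] by simp
  then show ?thesis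
    by (metis sup_ge1)
qed

lemma krivine_graph: "calc_graph n x h y \<Longrightarrow> \<tau> h = y"
  by (induction rule: calc_graph.induct)
    (simp_all add: krivine_zero krivine_proj krivine_add krivine_scale krivine_max
      calc_graph_hom_fun)

text \<open>The definition of a calculus demands no continuity; positivity and the order unit supply
  it.\<close>

lemma krivine_norm_le:
  assumes h: "h \<in> hom_fun n" and k: "k \<in> hom_fun n" and "0 \<le> c"
    and le: "\<And>t. t \<in> Rn n \<Longrightarrow> \<bar>h t - k t\<bar> \<le> c * unit_fun n t"
  shows "norm (\<tau> h - \<tau> k) \<le> c * norm (\<Sum>j<n. \<bar>x j\<bar>)"
proof -
  define U where "U = (\<Sum>j<n. \<bar>x j\<bar>)"
  have u: "unit_fun n \<in> hom_fun n" and U: "\<tau> (unit_fun n) = U"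
    using calc_graph_unit_fun calc_graph_hom_fun krivine_graph unfolding U_def by blast+
  have "\<tau> f \<le> \<tau> g + c *\<^sub>R U"
    if "f \<in> hom_fun n" "g \<in> hom_fun n" "\<And>t. t \<in> Rn n \<Longrightarrow> f t \<le> g t + c * unit_fun n t" for f g
    using krivine_mono[OF that(1) hom_fun_add[OF that(2) hom_fun_scale[OF u]]] that(3)
    by (simp add: krivine_add krivine_scale hom_fun_scale that(2) u U)
  from this[of h k] this[of k h] have "\<tau> h \<le> \<tau> k + c *\<^sub>R U" "\<tau> k \<le> \<tau> h + c *\<^sub>R U"
    using h k le by (force simp: abs_le_iff)+
  moreover have "0 \<le> c *\<^sub>R U"
    using assms(3) unfolding U_def by (intro scaleR_nonneg_nonneg sum_nonneg) auto
  ultimately have "\<bar>\<tau> h - \<tau> k\<bar> \<le> \<bar>c *\<^sub>R U\<bar>"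
    by (auto simp: abs_le_iff diff_le_eq add.commute)
  then have "norm (\<tau> h - \<tau> k) \<le> norm (c *\<^sub>R U)"
    by (rule norm_mono_abs)
  then show ?thesis
    using assms(3) by (simp add: U_def)
qed

text \<open>Any calculus agrees with \<open>calc_graph\<close> on piecewise linear functions, and
  continuity then determines it on the rest of \<open>hom_fun n\<close>. This is the uniqueness
  half.\<close>

lemma krivine_closure:
  assumes "h \<in> hom_fun n"
  shows "calc_closure n x h (\<tau> h)"
proof -
  define U where "U = (\<Sum>j<n. \<bar>x j\<bar>)"
  obtain y where y: "calc_closure n x h y"
    using calc_closure_exists[OF assms] .
  have "norm (\<tau> h - y) \<le> 0 + \<epsilon>" if "0 < \<epsilon>" for \<epsilon>
  proof -
    define \<eta> where "\<eta> = \<epsilon> / (norm U + 1)"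
    have "0 < norm U + 1"
      using norm_ge_zero[of U] by linarith
    with that have "0 < \<eta>" "\<eta> * (norm U + 1) = \<epsilon>"
      by (simp_all add: \<eta>_def)
    then have \<eta>: "0 < \<eta>" "\<eta> * norm U + \<eta> = \<epsilon>"
      by (simp_all add: algebra_simps)
    obtain g z where g: "calc_graph n x g z"
      "\<And>t. t \<in> Rn n \<Longrightarrow> \<bar>h t - g t\<bar> \<le> \<eta> * unit_fun n t" "norm (y - z) \<le> \<eta>"
      using calc_closureE[OF y \<eta>(1)] by blast
    have "norm (\<tau> h - \<tau> g) \<le> \<eta> * norm U"
      unfolding U_def using assms calc_graph_hom_fun[OF g(1)] \<eta>(1) g(2)
      by (intro krivine_norm_le) auto
    then show ?thesis
      using norm_triangle_ineq[of "\<tau> h - z" "z - y"] g(3) \<eta>(2) krivine_graph[OF g(1)]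
      by (simp add: norm_minus_commute)
  qed
  then have "norm (\<tau> h - y) \<le> 0"
    by (rule field_le_epsilon)
  with y show ?thesis
    by simp
qed

end

text \<open>The closure relation defines a calculus by choosing values that are in fact unique.
  Extensionality fixes the values outside \<open>hom_fun n\<close>, so the definite description
  denotes this map.\<close>

lemma is_krivine_calculus_krivine:
  fixes x :: "nat \<Rightarrow> 'a::banach_lattice"
  shows "is_krivine_calculus n x (krivine n x)"
proof -
  define \<tau> where "\<tau> = restrict (\<lambda>h. SOME y. calc_closure n x h y) (hom_fun n)"
  have cl: "calc_closure n x h (\<tau> h)" if "h \<in> hom_fun n" for h
    using calc_closure_exists[OF that, of x] that unfolding \<tau>_def by (auto intro: someI)
  have eqI: "\<tau> h = y" if "h \<in> hom_fun n" "calc_closure n x h y" for h y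
    using cl that calc_closure_unique by blast
  have "is_krivine_calculus n x \<tau>"
    unfolding is_krivine_calculus_def
    by (auto intro!: eqI hom_fun_add hom_fun_scale hom_fun_max hom_fun_proj calc_closure_add
        calc_closure_scale calc_closure_sup calc_closure_graph[OF calc_graph.proj] cl)
  moreover have "\<tau> \<in> extensional (hom_fun n)"
    by (simp add: \<tau>_def)
  moreover have "\<sigma> = \<tau>" if "\<sigma> \<in> extensional (hom_fun n)" "is_krivine_calculus n x \<sigma>" for \<sigma>
  proof (rule extensionalityI[OF that(1) \<open>\<tau> \<in> extensional (hom_fun n)\<close>])
    fix h assume "h \<in> hom_fun n"
    then show "\<sigma> h = \<tau> h"
      using krivine_closure[OF that(2)] cl calc_closure_unique by blast
  qed
  ultimately show ?thesis
    unfolding krivine_def using theI[of "\<lambda>\<tau>. \<tau> \<in> extensional (hom_fun n) \<and> is_krivine_calculus n x \<tau>" \<tau>]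
    by blast
qed

section \<open>The tuple norms\<close>

text \<open>A seminorm on a finite-dimensional space is Lipschitz for a weighted l1 norm, the
  weights being its values at the unit vectors. This covers both the norm of \<open>Y\<close> and
  the Koethe norm.\<close>

lemma seminorm_hom_fun:
  assumes add: "\<And>s t. s \<in> Rn n \<Longrightarrow> t \<in> Rn n \<Longrightarrow> p (\<lambda>i. s i + t i) \<le> p s + p t"
    and scale: "\<And>c t. t \<in> Rn n \<Longrightarrow> p (\<lambda>i. c * t i) = \<bar>c\<bar> * p t"
  shows "on_Rn n p \<in> hom_fun n"
proof -
  have unit: "unit_seq j \<in> Rn n" if "j < n" for j
    using that by (auto simp: unit_seq_def Rn_iff)
  \<comment> \<open>Coordinates are added one at a time, so that subadditivity applies to two
    summands in each step.\<close>
  have bound: "p (\<lambda>i. if i < m then t i else 0) \<le> (\<Sum>j<m. \<bar>t j\<bar> * p (unit_seq j))"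
    if "m \<le> n" for t m
    using that
  proof (induction m)
    case 0
    then show ?case
      using scale[of "\<lambda>_. 0" 0] by (simp add: Rn_iff)
  next
    case (Suc m)
    have eq: "(\<lambda>i. if i < Suc m then t i else 0)
        = (\<lambda>i. (if i < m then t i else 0) + t m * unit_seq m i)"
      by (auto simp: unit_seq_def less_Suc_eq)
    have "p (\<lambda>i. if i < Suc m then t i else 0)
        \<le> p (\<lambda>i. if i < m then t i else 0) + p (\<lambda>i. t m * unit_seq m i)"
      unfolding eq using Suc.prems by (intro add) (auto simp: Rn_iff unit_seq_def)
    with Suc scale[OF unit[of m], of "t m"] show ?case
      by simp
  qed
  have p_le: "p t \<le> (\<Sum>j<n. \<bar>t j\<bar> * p (unit_seq j))" if "t \<in> Rn n" for t
  proof -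
    have "(\<lambda>i. if i < n then t i else 0) = t"
      using that by (auto simp: Rn_iff)
    with bound[of n t] show ?thesis
      by simp
  qed
  have diff: "p s - p t \<le> (\<Sum>j<n. \<bar>s j - t j\<bar> * p (unit_seq j))" if "s \<in> Rn n" "t \<in> Rn n" for s t
  proof -
    have st: "(\<lambda>i. s i - t i) \<in> Rn n"
      using that by (simp add: Rn_iff)
    have "p s \<le> p (\<lambda>i. s i - t i) + p t"
      using add[OF st that(2)] by simp
    with p_le[OF st] show ?thesis
      by linarith
  qed
  have "continuous_on (Rn n) p"
    unfolding continuous_on
  proof
    fix t assume t: "t \<in> Rn n"
    have coord: "((\<lambda>s. s j) \<longlongrightarrow> t j) (at t within Rn n)" for j
      using continuous_on_subset[OF continuous_on_product_coordinates[of j] subset_UNIV] t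
      unfolding continuous_on by blast
    have "((\<lambda>s. \<Sum>j<n. \<bar>s j - t j\<bar> * p (unit_seq j)) \<longlongrightarrow> (\<Sum>j<n. \<bar>t j - t j\<bar> * p (unit_seq j)))
        (at t within Rn n)"
      by (intro tendsto_intros coord)
    then have lim: "((\<lambda>s. \<Sum>j<n. \<bar>s j - t j\<bar> * p (unit_seq j)) \<longlongrightarrow> 0) (at t within Rn n)"
      by simp
    have "((\<lambda>s. p s - p t) \<longlongrightarrow> 0) (at t within Rn n)"
    proof (rule Lim_null_comparison[OF _ lim])
      have "\<bar>p s - p t\<bar> \<le> (\<Sum>j<n. \<bar>s j - t j\<bar> * p (unit_seq j))" if "s \<in> Rn n" for s
        using diff[OF that t] diff[OF t that] by (simp only: abs_le_iff abs_minus_commute minus_diff_eq)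
      then show "\<forall>\<^sub>F s in at t within Rn n. norm (p s - p t) \<le> (\<Sum>j<n. \<bar>s j - t j\<bar> * p (unit_seq j))"
        by (auto simp: eventually_at_filter)
    qed
    then show "(p \<longlongrightarrow> p t) (at t within Rn n)"
      by (rule Lim_null[THEN iffD2])
  qed
  then have "continuous_on (Rn n) (on_Rn n p)"
    by (simp add: on_Rn_def cong: continuous_on_cong)
  moreover have "(\<lambda>i. c * t i) \<in> Rn n" if "t \<in> Rn n" for c t
    using that by (simp add: Rn_iff)
  ultimately show ?thesis
    unfolding hom_fun_iff by (simp add: on_Rn_def scale)
qed

section \<open>The Koethe norm on finite tuples and Hoelder's inequality\<close>

context
  fixes Y :: seq_space
  assumes Y: "banach_sequence_lattice Y"
begin

lemma seq_lattice_zero: "(\<lambda>_. 0) \<in> seqs Y"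
  and seq_lattice_add: "f \<in> seqs Y \<Longrightarrow> g \<in> seqs Y \<Longrightarrow> (\<lambda>i. f i + g i) \<in> seqs Y"
  and seq_lattice_scale: "f \<in> seqs Y \<Longrightarrow> (\<lambda>i. c * f i) \<in> seqs Y"
  and seq_lattice_unit: "unit_seq k \<in> seqs Y"
  and seq_norm_nonneg: "f \<in> seqs Y \<Longrightarrow> 0 \<le> seq_norm Y f"
  and seq_norm_eq_0: "f \<in> seqs Y \<Longrightarrow> seq_norm Y f = 0 \<longleftrightarrow> f = (\<lambda>_. 0)"
  and seq_norm_scale: "f \<in> seqs Y \<Longrightarrow> seq_norm Y (\<lambda>i. c * f i) = \<bar>c\<bar> * seq_norm Y f"
  and seq_norm_add: "f \<in> seqs Y \<Longrightarrow> g \<in> seqs Y \<Longrightarrow>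
    seq_norm Y (\<lambda>i. f i + g i) \<le> seq_norm Y f + seq_norm Y g"
  and seq_norm_ideal: "g \<in> seqs Y \<Longrightarrow> (\<And>i. \<bar>f i\<bar> \<le> \<bar>g i\<bar>) \<Longrightarrow> seq_norm Y f \<le> seq_norm Y g"
  using Y unfolding banach_sequence_lattice_def by simp_all

lemma Rn_seqs:
  assumes "t \<in> Rn n"
  shows "t \<in> seqs Y"
proof -
  have "(\<lambda>i. if i < m then t i else 0) \<in> seqs Y" for m
  proof (induction m)
    case 0
    then show ?case
      using seq_lattice_zero by simp
  next
    case (Suc m)
    have "(\<lambda>i. if i < Suc m then t i else 0)
        = (\<lambda>i. (if i < m then t i else 0) + t m * unit_seq m i)"
      by (auto simp: unit_seq_def less_Suc_eq)
    with Suc show ?case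
      by (simp add: seq_lattice_add seq_lattice_scale seq_lattice_unit)
  qed
  moreover have "(\<lambda>i. if i < n then t i else 0) = t"
    using assms by (auto simp: Rn_iff)
  ultimately show ?thesis
    by metis
qed

lemma seq_norm_hom_fun: "on_Rn n (seq_norm Y) \<in> hom_fun n"
  by (rule seminorm_hom_fun) (auto simp: seq_norm_add seq_norm_scale Rn_seqs)

lemma koethe_norm_Rn:
  assumes "s \<in> Rn n"
  shows "seq_norm (koethe_space Y) s
    = (SUP \<alpha>\<in>{\<alpha>\<in>seqs Y. seq_norm Y \<alpha> \<le> 1}. \<Sum>i<n. \<bar>\<alpha> i * s i\<bar>)"
proof -
  have "(\<Sum>i. \<bar>\<alpha> i * s i\<bar>) = (\<Sum>i<n. \<bar>\<alpha> i * s i\<bar>)" for \<alpha>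
    using assms by (intro suminf_finite) (auto simp: Rn_iff)
  then show ?thesis
    by (simp add: koethe_space_def)
qed

text \<open>By the ideal property the coordinate functionals are bounded on the unit ball of
  \<open>Y\<close>. Hence the real supremum defining the Koethe norm of a finite tuple is a genuine
  one.\<close>

lemma bdd_above_koethe:
  "bdd_above ((\<lambda>\<alpha>. \<Sum>i<n. \<bar>\<alpha> i * s i\<bar>) ` {\<alpha>\<in>seqs Y. seq_norm Y \<alpha> \<le> 1})"
proof (rule bdd_aboveI2)
  fix \<alpha> assume \<alpha>: "\<alpha> \<in> {\<alpha>\<in>seqs Y. seq_norm Y \<alpha> \<le> 1}"
  have "\<bar>\<alpha> i\<bar> \<le> 1 / seq_norm Y (unit_seq i)" for i
  proof -
    have "unit_seq i \<noteq> (\<lambda>_. 0)"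
      by (auto simp: unit_seq_def fun_eq_iff)
    then have pos: "0 < seq_norm Y (unit_seq i)"
      using seq_norm_eq_0[OF seq_lattice_unit, of i] seq_norm_nonneg[OF seq_lattice_unit, of i]
      by linarith
    have "\<bar>\<alpha> i\<bar> * seq_norm Y (unit_seq i) = seq_norm Y (\<lambda>j. \<alpha> i * unit_seq i j)"
      by (simp add: seq_norm_scale seq_lattice_unit)
    also have "\<dots> \<le> seq_norm Y \<alpha>"
      using \<alpha> by (intro seq_norm_ideal) (auto simp: unit_seq_def)
    finally show ?thesis
      using \<alpha> pos by (simp add: field_simps)
  qed
  then show "(\<Sum>i<n. \<bar>\<alpha> i * s i\<bar>) \<le> (\<Sum>i<n. 1 / seq_norm Y (unit_seq i) * \<bar>s i\<bar>)"
    unfolding abs_mult by (intro sum_mono mult_right_mono) auto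
qed

lemma koethe_norm_ge:
  assumes "\<alpha> \<in> seqs Y" "seq_norm Y \<alpha> \<le> 1" "s \<in> Rn n"
  shows "(\<Sum>i<n. \<bar>\<alpha> i * s i\<bar>) \<le> seq_norm (koethe_space Y) s"
  unfolding koethe_norm_Rn[OF assms(3)] using assms by (intro cSUP_upper bdd_above_koethe) auto

lemma koethe_norm_le:
  assumes "s \<in> Rn n"
    and "\<And>\<alpha>. \<alpha> \<in> seqs Y \<Longrightarrow> seq_norm Y \<alpha> \<le> 1 \<Longrightarrow> (\<Sum>i<n. \<bar>\<alpha> i * s i\<bar>) \<le> c"
  shows "seq_norm (koethe_space Y) s \<le> c"
proof -
  have "(\<lambda>_. 0) \<in> {\<alpha>\<in>seqs Y. seq_norm Y \<alpha> \<le> 1}"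
    using seq_lattice_zero seq_norm_eq_0[OF seq_lattice_zero] by simp
  then show ?thesis
    unfolding koethe_norm_Rn[OF assms(1)] using assms(2) by (intro cSUP_least) auto
qed

lemma koethe_norm_hom_fun: "on_Rn n (seq_norm (koethe_space Y)) \<in> hom_fun n"
proof (rule seminorm_hom_fun)
  let ?q = "seq_norm (koethe_space Y)"
  fix s t :: "nat \<Rightarrow> real" assume st: "s \<in> Rn n" "t \<in> Rn n"
  show "?q (\<lambda>i. s i + t i) \<le> ?q s + ?q t"
  proof (rule koethe_norm_le)
    show "(\<lambda>i. s i + t i) \<in> Rn n"
      using st by (simp add: Rn_iff)
    fix \<alpha> assume \<alpha>: "\<alpha> \<in> seqs Y" "seq_norm Y \<alpha> \<le> 1"
    have "(\<Sum>i<n. \<bar>\<alpha> i * (s i + t i)\<bar>) \<le> (\<Sum>i<n. \<bar>\<alpha> i * s i\<bar>) + (\<Sum>i<n. \<bar>\<alpha> i * t i\<bar>)"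
      unfolding sum.distrib[symmetric] distrib_left by (intro sum_mono abs_triangle_ineq)
    with koethe_norm_ge[OF \<alpha> st(1)] koethe_norm_ge[OF \<alpha> st(2)]
    show "(\<Sum>i<n. \<bar>\<alpha> i * (s i + t i)\<bar>) \<le> ?q s + ?q t"
      by linarith
  qed
next
  let ?q = "seq_norm (koethe_space Y)"
  have Rn_scale: "(\<lambda>i. c * t i) \<in> Rn n" if "t \<in> Rn n" for c t
    using that by (simp add: Rn_iff)
  have le: "?q (\<lambda>i. c * t i) \<le> \<bar>c\<bar> * ?q t" if t: "t \<in> Rn n" for c t
  proof (rule koethe_norm_le[OF Rn_scale[OF t]])
    fix \<alpha> assume \<alpha>: "\<alpha> \<in> seqs Y" "seq_norm Y \<alpha> \<le> 1"
    have "(\<Sum>i<n. \<bar>\<alpha> i * (c * t i)\<bar>) = \<bar>c\<bar> * (\<Sum>i<n. \<bar>\<alpha> i * t i\<bar>)"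
      by (simp add: abs_mult sum_distrib_left mult_ac)
    also have "\<dots> \<le> \<bar>c\<bar> * ?q t"
      using koethe_norm_ge[OF \<alpha> t] by (intro mult_left_mono) auto
    finally show "(\<Sum>i<n. \<bar>\<alpha> i * (c * t i)\<bar>) \<le> \<bar>c\<bar> * ?q t" .
  qed
  fix c and t :: "nat \<Rightarrow> real" assume t: "t \<in> Rn n"
  have nonneg: "0 \<le> ?q (\<lambda>i. c * t i)"
    using koethe_norm_ge[OF seq_lattice_zero _ Rn_scale[OF t]] seq_norm_eq_0[OF seq_lattice_zero]
    by simp
  \<comment> \<open>The inequality \<open>le\<close> used for \<open>c\<close> and for its inverse
    gives equality; the case 0 is separate.\<close>
  show "?q (\<lambda>i. c * t i) = \<bar>c\<bar> * ?q t"
  proof (cases "c = 0")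
    case True
    then show ?thesis
      using le[OF t, of 0] nonneg by simp
  next
    case False
    have "?q t \<le> \<bar>inverse c\<bar> * ?q (\<lambda>i. c * t i)"
      using le[OF Rn_scale[OF t, of c], of "inverse c"] False by (simp add: mult.assoc[symmetric])
    then have "\<bar>c\<bar> * ?q t \<le> ?q (\<lambda>i. c * t i)"
      using False by (simp add: field_simps)
    with le[OF t, of c] show ?thesis
      by simp
  qed
qed

lemma koethe_norm_nonneg:
  assumes "s \<in> Rn n"
  shows "0 \<le> seq_norm (koethe_space Y) s"
  using koethe_norm_ge[OF seq_lattice_zero _ assms] seq_norm_eq_0[OF seq_lattice_zero] by simp

text \<open>For nonzero \<open>t\<close>, dividing by its norm gives a competitor in the supremum
  defining the Koethe norm.\<close>

lemma koethe_hoelder: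
  assumes t: "t \<in> Rn n" and s: "s \<in> Rn n"
  shows "(\<Sum>i<n. \<bar>t i * s i\<bar>) \<le> seq_norm Y t * seq_norm (koethe_space Y) s"
proof (cases "t = (\<lambda>_. 0)")
  case True
  then show ?thesis
    using seq_norm_eq_0[OF Rn_seqs[OF t]] by simp
next
  case False
  define r where "r = seq_norm Y t"
  have "0 < r"
    using False seq_norm_eq_0[OF Rn_seqs[OF t]] seq_norm_nonneg[OF Rn_seqs[OF t]]
    unfolding r_def by linarith
  have "(\<Sum>i<n. \<bar>(inverse r * t i) * s i\<bar>) \<le> seq_norm (koethe_space Y) s"
    using \<open>0 < r\<close> Rn_seqs[OF t] s
    by (intro koethe_norm_ge) (auto simp: seq_lattice_scale seq_norm_scale r_def[symmetric])
  then have "inverse r * (\<Sum>i<n. \<bar>t i * s i\<bar>) \<le> seq_norm (koethe_space Y) s"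
    using \<open>0 < r\<close> by (simp add: abs_mult sum_distrib_left mult.assoc)
  then show ?thesis
    using \<open>0 < r\<close> by (simp add: r_def[symmetric] field_simps)
qed

end

section \<open>The duality inequality\<close>

lemma dual_apply_sum_left: "dual_apply (\<Sum>i\<in>I. \<phi> i) x = (\<Sum>i\<in>I. dual_apply (\<phi> i) x)"
  by (induction I rule: infinite_finite_induct) auto

lemma dual_apply_sum_right: "dual_apply \<phi> (\<Sum>i\<in>I. x i) = (\<Sum>i\<in>I. dual_apply \<phi> (x i))"
  by (induction I rule: infinite_finite_induct) auto

lemma dual_apply_mono_left: "\<phi> \<le> \<psi> \<Longrightarrow> 0 \<le> x \<Longrightarrow> dual_apply \<phi> x \<le> dual_apply \<psi> x"
  by (simp add: less_eq_dual_def)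

lemma dual_apply_mono_right:
  assumes "0 \<le> \<phi>" "x \<le> y"
  shows "dual_apply \<phi> x \<le> dual_apply \<phi> y"
  using dual_apply_mono_left[OF assms(1), of "y - x"] assms(2) by simp

theorem lemma31:
  fixes Y :: seq_space
    and n :: nat
    and x :: "nat \<Rightarrow> 'a::banach_lattice"
    and \<phi> :: "nat \<Rightarrow> 'a dual"
  assumes "banach_sequence_lattice Y"
  shows "(\<Sum>j<n. \<bar>dual_apply (\<phi> j) (x j)\<bar>)
    \<le> dual_apply (tuple_norm (koethe_space Y) n \<phi>) (tuple_norm Y n x)"
proof -
  define \<tau> where "\<tau> = krivine n x"
  define \<rho> where "\<rho> = krivine n \<phi>"
  have \<tau>: "is_krivine_calculus n x \<tau>" and \<rho>: "is_krivine_calculus n \<phi> \<rho>"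
    by (simp_all add: \<tau>_def \<rho>_def is_krivine_calculus_krivine)
  define p where "p = on_Rn n (seq_norm Y)"
  define q where "q = on_Rn n (seq_norm (koethe_space Y))"
  have p: "p \<in> hom_fun n" and q: "q \<in> hom_fun n"
    unfolding p_def q_def using assms by (simp_all add: seq_norm_hom_fun koethe_norm_hom_fun)
  have "0 \<le> \<rho> q"
    using krivine_mono[OF \<rho> hom_fun_zero q] krivine_zero[OF \<rho>] koethe_norm_nonneg[OF assms]
    by (simp add: q_def on_Rn_def)
  \<comment> \<open>The signs remove the absolute values, leaving an expression linear in the
    functionals and in the vectors.\<close>
  define \<sigma> where "\<sigma> j = sgn (dual_apply (\<phi> j) (x j))" for j
  define U where "U = \<tau> (unit_fun n)"
  define V where "V = norm (\<Sum>j<n. \<bar>x j\<bar>)"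
  have u: "unit_fun n \<in> hom_fun n"
    using calc_graph_hom_fun[OF calc_graph_unit_fun] .
  \<comment> \<open>Collects the errors: the first term comes from approximating \<open>p\<close>,
    the second from approximating each \<open>x j\<close>. It does not depend on
    \<open>\<epsilon>\<close>.\<close>
  define C where "C = dual_apply (\<rho> q) U + (\<Sum>j<n. norm (\<phi> j) * V)"
  have main: "(\<Sum>j<n. \<bar>dual_apply (\<phi> j) (x j)\<bar>) \<le> dual_apply (\<rho> q) (\<tau> p) + \<epsilon> * C"
    if "0 < \<epsilon>" for \<epsilon>
  proof -
    \<comment> \<open>The norm and all coordinate functions are approximated with the same nodes, so
      that the two approximations can be combined term by term.\<close>
    have "finite (insert p ((\<lambda>j. on_Rn n (\<lambda>t. t j)) ` {..<n}))"
      "insert p ((\<lambda>j. on_Rn n (\<lambda>t. t j)) ` {..<n}) \<subseteq> hom_fun n"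
      using p hom_fun_proj by auto
    then obtain N and e :: "nat \<Rightarrow> (nat \<Rightarrow> real) \<Rightarrow> real" and a :: "nat \<Rightarrow> nat \<Rightarrow> real"
      where graph: "\<And>i. \<exists>z. calc_graph n x (e i) z"
        and a: "\<And>i. i < N \<Longrightarrow> a i \<in> Rn n" and e0: "\<And>i t. 0 \<le> e i t"
        and le: "\<And>h t. h \<in> insert p ((\<lambda>j. on_Rn n (\<lambda>t. t j)) ` {..<n}) \<Longrightarrow> t \<in> Rn n \<Longrightarrow>
          \<bar>h t - (\<Sum>i<N. h (a i) * e i t)\<bar> \<le> \<epsilon> * unit_fun n t"
      using \<open>0 < \<epsilon>\<close> by (rule hom_fun_approx) (rule that, assumption+)
    have e: "e i \<in> hom_fun n" for i
      using graph calc_graph_hom_fun by blast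
    have e_pos: "0 \<le> \<tau> (e i)" for i
      using krivine_mono[OF \<tau> hom_fun_zero e] e0 krivine_zero[OF \<tau>] by simp
    have simple: "(\<lambda>t. \<Sum>i<N. c i * e i t) \<in> hom_fun n"
      "\<tau> (\<lambda>t. \<Sum>i<N. c i * e i t) = (\<Sum>i<N. c i *\<^sub>R \<tau> (e i))" for c
      by (auto intro!: hom_fun_sum hom_fun_scale e
          simp: krivine_sum[OF \<tau>] krivine_scale[OF \<tau>] hom_fun_scale e)
    have x_le: "norm (x j - (\<Sum>i<N. a i j *\<^sub>R \<tau> (e i))) \<le> \<epsilon> * V" if "j < n" for j
    proof -
      have "norm (\<tau> (on_Rn n (\<lambda>t. t j)) - \<tau> (\<lambda>t. \<Sum>i<N. a i j * e i t)) \<le> \<epsilon> * V"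
        unfolding V_def
      proof (rule krivine_norm_le[OF \<tau> hom_fun_proj simple(1)])
        fix t assume "t \<in> Rn n"
        then have "\<bar>on_Rn n (\<lambda>t. t j) t - (\<Sum>i<N. on_Rn n (\<lambda>t. t j) (a i) * e i t)\<bar>
            \<le> \<epsilon> * unit_fun n t"
          using that by (intro le) auto
        moreover have "(\<Sum>i<N. on_Rn n (\<lambda>t. t j) (a i) * e i t) = (\<Sum>i<N. a i j * e i t)"
          using a by (intro sum.cong) (auto simp: on_Rn_def)
        ultimately show "\<bar>on_Rn n (\<lambda>t. t j) t - (\<Sum>i<N. a i j * e i t)\<bar> \<le> \<epsilon> * unit_fun n t"
          by simp
      qed (use \<open>0 < \<epsilon>\<close> in simp)
      then show ?thesis
        using that by (simp add: krivine_proj[OF \<tau>] simple)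
    qed
    have p_le: "(\<Sum>i<N. p (a i) *\<^sub>R \<tau> (e i)) \<le> \<tau> p + \<epsilon> *\<^sub>R U"
    proof -
      have "\<tau> (\<lambda>t. \<Sum>i<N. p (a i) * e i t) \<le> \<tau> (\<lambda>t. p t + \<epsilon> * unit_fun n t)"
        using le[of p] by (intro krivine_mono[OF \<tau>] simple hom_fun_add hom_fun_scale p u) force
      then show ?thesis
        by (simp add: simple krivine_add[OF \<tau>] krivine_scale[OF \<tau>] p u hom_fun_scale U_def)
    qed
    text \<open>At a fixed point \<open>a i\<close> the inequality is linear in the functionals, so
      positivity of the calculus in the dual suffices.\<close>
    have \<phi>_le: "(\<Sum>j<n. (\<sigma> j * a i j) *\<^sub>R \<phi> j) \<le> p (a i) *\<^sub>R \<rho> q" if "i < N" for i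
    proof -
      have lin: "(\<lambda>s. \<Sum>j<n. (\<sigma> j * a i j) * on_Rn n (\<lambda>t. t j) s) \<in> hom_fun n"
        by (intro hom_fun_sum hom_fun_scale hom_fun_proj)
      have "\<rho> (\<lambda>s. \<Sum>j<n. (\<sigma> j * a i j) * on_Rn n (\<lambda>t. t j) s) \<le> \<rho> (\<lambda>s. p (a i) * q s)"
      proof (rule krivine_mono[OF \<rho> lin hom_fun_scale[OF q]])
        fix s assume s: "s \<in> Rn n"
        have "\<bar>\<sigma> j\<bar> \<le> 1" for j
          by (simp add: \<sigma>_def abs_sgn_eq)
        then have "\<sigma> j * a i j * s j \<le> \<bar>a i j * s j\<bar>" for j
          using abs_ge_self[of "\<sigma> j * a i j * s j"]
            mult_right_mono[of "\<bar>\<sigma> j\<bar>" 1 "\<bar>a i j * s j\<bar>"]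
          by (simp add: abs_mult mult.assoc)
        then have "(\<Sum>j<n. \<sigma> j * a i j * s j) \<le> (\<Sum>j<n. \<bar>a i j * s j\<bar>)"
          by (intro sum_mono)
        also have "\<dots> \<le> p (a i) * q s"
          using koethe_hoelder[OF assms a[OF that] s] a[OF that] s
          by (simp add: p_def q_def on_Rn_def)
        finally show "(\<Sum>j<n. (\<sigma> j * a i j) * on_Rn n (\<lambda>t. t j) s) \<le> p (a i) * q s"
          using s by (simp add: on_Rn_def)
      qed
      then show ?thesis
        by (simp add: krivine_sum[OF \<rho>] krivine_scale[OF \<rho>] krivine_proj[OF \<rho>]
            hom_fun_scale hom_fun_proj q)
    qed
    have abs_eq: "\<bar>dual_apply (\<phi> j) (x j)\<bar> = \<sigma> j * dual_apply (\<phi> j) (x j)" for j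
      by (simp add: \<sigma>_def abs_sgn mult.commute)
    have "\<bar>dual_apply (\<phi> j) (x j)\<bar>
        \<le> \<sigma> j * dual_apply (\<phi> j) (\<Sum>i<N. a i j *\<^sub>R \<tau> (e i)) + \<epsilon> * (norm (\<phi> j) * V)"
      if "j < n" for j
    proof -
      define d where "d = x j - (\<Sum>i<N. a i j *\<^sub>R \<tau> (e i))"
      have "\<sigma> j * dual_apply (\<phi> j) d \<le> \<bar>\<sigma> j\<bar> * \<bar>dual_apply (\<phi> j) d\<bar>"
        by (simp flip: abs_mult)
      also have "\<dots> \<le> 1 * (norm (\<phi> j) * norm d)"
        by (intro mult_mono abs_dual_apply_le) (auto simp: \<sigma>_def abs_sgn_eq)
      also have "\<dots> \<le> norm (\<phi> j) * (\<epsilon> * V)"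
        using x_le[OF that] by (simp add: d_def mult_left_mono)
      finally have "\<sigma> j * dual_apply (\<phi> j) d \<le> \<epsilon> * (norm (\<phi> j) * V)"
        by (simp add: mult_ac)
      then show ?thesis
        by (simp add: abs_eq d_def right_diff_distrib)
    qed
    then have "(\<Sum>j<n. \<bar>dual_apply (\<phi> j) (x j)\<bar>)
        \<le> (\<Sum>j<n. \<sigma> j * dual_apply (\<phi> j) (\<Sum>i<N. a i j *\<^sub>R \<tau> (e i)) + \<epsilon> * (norm (\<phi> j) * V))"
      by (intro sum_mono) auto
    also have "\<dots> = (\<Sum>j<n. \<sigma> j * dual_apply (\<phi> j) (\<Sum>i<N. a i j *\<^sub>R \<tau> (e i)))
        + \<epsilon> * (\<Sum>j<n. norm (\<phi> j) * V)"
      by (simp add: sum.distrib sum_distrib_left)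
    \<comment> \<open>Exchanging the sums gathers, at each node \<open>a i\<close>, all functionals
      into one acting on the positive vector \<open>\<tau> (e i)\<close>.\<close>
    also have "(\<Sum>j<n. \<sigma> j * dual_apply (\<phi> j) (\<Sum>i<N. a i j *\<^sub>R \<tau> (e i)))
        = (\<Sum>i<N. dual_apply (\<Sum>j<n. (\<sigma> j * a i j) *\<^sub>R \<phi> j) (\<tau> (e i)))"
      by (simp add: dual_apply_sum_left dual_apply_sum_right sum_distrib_left mult.assoc)
        (rule sum.swap)
    also have "\<dots> \<le> (\<Sum>i<N. dual_apply (p (a i) *\<^sub>R \<rho> q) (\<tau> (e i)))"
      using \<phi>_le e_pos by (intro sum_mono dual_apply_mono_left) auto
    also have "\<dots> = dual_apply (\<rho> q) (\<Sum>i<N. p (a i) *\<^sub>R \<tau> (e i))"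
      by (simp add: dual_apply_sum_right)
    also have "\<dots> \<le> dual_apply (\<rho> q) (\<tau> p + \<epsilon> *\<^sub>R U)"
      using \<open>0 \<le> \<rho> q\<close> p_le by (rule dual_apply_mono_right)
    finally show ?thesis
      by (simp add: C_def algebra_simps)
  qed
  \<comment> \<open>The bound holds for every positive \<open>\<epsilon>\<close>, and the error
    vanishes as \<open>\<epsilon>\<close> decreases to 0.\<close>
  have "((\<lambda>\<epsilon>. dual_apply (\<rho> q) (\<tau> p) + \<epsilon> * C) \<longlongrightarrow> dual_apply (\<rho> q) (\<tau> p) + 0 * C) (at_right 0)"
    by (intro tendsto_intros)
  then have "(\<Sum>j<n. \<bar>dual_apply (\<phi> j) (x j)\<bar>) \<le> dual_apply (\<rho> q) (\<tau> p) + 0 * C"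
    by (rule tendsto_lowerbound) (use main in \<open>auto simp: eventually_at_right_less eventually_at_filter\<close>)
  then show ?thesis
    by (simp add: tuple_norm_def p_def q_def \<tau>_def \<rho>_def)
qed

end
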